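(* Let $p,d,\ell\in\mathbb{N}^+$, let $\mathscr B=\mathbb{R}^p$ equipped with the sup norm $|\cdot|$, and for $1\le j\le\ell$ let $F_j$ be a $C^{M_j}$ smooth map from $\mathbb{T}^d$ to $\mathscr B$, where $2\le M_j\le+\infty$. Assume that there exists an integer $m\ge2$ such that $\rho_1,\dots,\rho_\ell\in\mathbb{T}^d$ satisfy the finite-dimensional joint Diophantine condition with exponent $\tau$ (discrete version for the discrete average, continuous version for the continuous average) and $\min_{1\le j\le\ell}M_j>d+m\tau$. Then $$\Big|\mathrm{DMW}_N^\ell(\mathcal F)(\theta)-\prod_{j=1}^\ell\Big(\int_{\mathbb{T}^d}F_j(\hat\theta)\,d\hat\theta\Big)\Big|=\mathcal{O}(N^{-m})$$ and $$\Big|\mathrm{CMW}_T^\ell(\mathcal F)(\theta)-\prod_{j=1}^\ell\Big(\int_{\mathbb{T}^d}F_j(\hat\theta)\,d\hat\theta\Big)\Big|=\mathcal{O}(T^{-m})$$ whenever $N\in\mathbb N^+$ and $T>0$ are sufficiently large.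
   Context: Weight: $w(x)=\exp(-x^{-1}(1-x)^{-1})\big(\int_0^1\exp(-t^{-1}(1-t)^{-1})dt\big)^{-1}$ for $x\in(0,1)$ and $w(x)=0$ otherwise. Torus and rotations: $\mathbb{T}^d=[0,1]^d$ with coordinates mod 1; for $\rho\in\mathbb{T}^d$ and $s\ge0$, $\mathscr{T}_\rho^s(\theta)=\theta+s\rho \bmod 1$ in each coordinate. Averages: with $A_N=\sum_{s=0}^{N-1}w(s/N)$, $$\mathrm{DMW}_N^\ell(\mathcal F)(\theta)=\frac1{A_N}\sum_{n=0}^{N-1}w(n/N)F_1(\mathscr{T}_{\rho_1}^n(\theta))\cdots F_\ell(\mathscr{T}_{\rho_\ell}^n(\theta)),$$ $$\mathrm{CMW}_T^\ell(\mathcal F)(\theta)=\frac1T\int_0^T w(s/T)F_1(\mathscr{T}_{\rho_1}^s(\theta))\cdots F_\ell(\mathscr{T}_{\rho_\ell}^s(\theta))\,ds .$$ Products of vectors in $\mathbb{R}^p$ are Hadamard (componentwise) products. $\|k\|$ is the $1$-norm of an integer vector. Finite-dimensional joint Diophantine condition with exponent $\tau$: there is $\alpha>0$ such that the joint rotation $\tilde\rho=(\rho_1,\dots,\rho_\ell)\in\mathbb{T}^{d\ell}$ satisfies, in the discrete case, $|k\cdot\tilde\rho-n|\ge\alpha/\|k\|^\tau$ for all $0\ne k\in\mathbb{Z}^{d\ell}$ and all $n\in\mathbb{Z}$, with $\tau>d\ell$; in the continuous case, $|k\cdot\tilde\rho|\ge\alpha/\|k\|^\tau$ for all $0\ne k\in\mathbb{Z}^{d\ell}$,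 with $\tau>d\ell-1$. $\mathcal{O}(\cdot)$ means bounded by a constant, independent of $N$ (resp. $T$), times the argument for all sufficiently large $N$ (resp. $T$). *)

theory Defs
  imports "HOL-Analysis.Analysis"
begin

(* At t = 0 and t = 1 the convention inverse 0 = 0 makes the integrand 1 instead of 0; this null
   set does not affect the integral. *)
definition weight :: "real \<Rightarrow> real" where
  "weight x = (if 0 < x \<and> x < 1
     then exp (- (inverse x * inverse (1 - x)))
          * inverse (integral {0..1} (\<lambda>t. exp (- (inverse t * inverse (1 - t)))))
     else 0)"

(* Points of the torus are represented by vectors in [0,1]^d.  Functions on the torus are
   represented by functions on R^d with period 1 in each coordinate. *)
definition torus :: "(real^'d) set" where
  "torus = {\<theta>. \<forall>i. 0 \<le> \<theta> $ i \<and> \<theta> $ i \<le> 1}"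

definition torus_periodic :: "(real^'d \<Rightarrow> 'b) \<Rightarrow> bool" where
  "torus_periodic f \<longleftrightarrow> (\<forall>\<theta> i. f (\<theta> + axis i 1) = f \<theta>)"

definition rotation :: "real^'d \<Rightarrow> real \<Rightarrow> real^'d \<Rightarrow> real^'d" where
  "rotation r s \<theta> = (\<chi> i. frac (\<theta> $ i + s * r $ i))"

primrec cont_diff :: "nat \<Rightarrow> ('a::euclidean_space \<Rightarrow> 'b::euclidean_space) \<Rightarrow> bool" where
  "cont_diff 0 f \<longleftrightarrow> continuous_on UNIV f"
| "cont_diff (Suc n) f \<longleftrightarrow>
     f differentiable_on UNIV \<and> (\<forall>v. cont_diff n (\<lambda>x. frechet_derivative f (at x) v))"

definition smooth_on_torus :: "enat \<Rightarrow> (real^'d \<Rightarrow> 'b::euclidean_space) \<Rightarrow> bool" where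
  "smooth_on_torus M f \<longleftrightarrow>
     torus_periodic f \<and> (\<forall>n. enat n \<le> M \<longrightarrow> cont_diff n f)"

definition weight_sum :: "nat \<Rightarrow> real" where
  "weight_sum N = (\<Sum>s<N. weight (real s / real N))"

(* Multiplication on real^'p is componentwise (Hadamard), so the products below are Hadamard
   products. *)
definition DMW :: "('l::finite \<Rightarrow> real^'d \<Rightarrow> real^'p) \<Rightarrow> real^'d^'l \<Rightarrow> nat \<Rightarrow> real^'d \<Rightarrow> real^'p" where
  "DMW F \<rho> N \<theta> = (1 / weight_sum N) *\<^sub>R
     (\<Sum>n<N. weight (real n / real N) *\<^sub>R (\<Prod>j\<in>UNIV. F j (rotation (\<rho> $ j) (real n) \<theta>)))"

definition CMW :: "('l::finite \<Rightarrow> real^'d \<Rightarrow> real^'p) \<Rightarrow> real^'d^'l \<Rightarrow> real \<Rightarrow> real^'d \<Rightarrow> real^'p" where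
  "CMW F \<rho> T \<theta> = (1 / T) *\<^sub>R
     integral {0..T} (\<lambda>s. weight (s / T) *\<^sub>R (\<Prod>j\<in>UNIV. F j (rotation (\<rho> $ j) s \<theta>)))"

definition spatial_average :: "('l::finite \<Rightarrow> real^'d \<Rightarrow> real^'p) \<Rightarrow> real^'p" where
  "spatial_average F = (\<Prod>j\<in>UNIV. integral torus (F j))"

definition int_norm1 :: "int^'d^'l \<Rightarrow> real" where
  "int_norm1 k = (\<Sum>j\<in>UNIV. \<Sum>i\<in>UNIV. \<bar>real_of_int (k $ j $ i)\<bar>)"

definition int_dot :: "int^'d^'l \<Rightarrow> real^'d^'l \<Rightarrow> real" where
  "int_dot k \<rho> = (\<Sum>j\<in>UNIV. \<Sum>i\<in>UNIV. real_of_int (k $ j $ i) * \<rho> $ j $ i)"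

definition joint_diophantine_discrete :: "real \<Rightarrow> real^'d^'l \<Rightarrow> bool" where
  "joint_diophantine_discrete \<tau> \<rho> \<longleftrightarrow>
     \<tau> > real (CARD('d) * CARD('l)) \<and>
     (\<exists>\<alpha>>0. \<forall>k. k \<noteq> 0 \<longrightarrow>
        (\<forall>n::int. \<bar>int_dot k \<rho> - real_of_int n\<bar> \<ge> \<alpha> / int_norm1 k powr \<tau>))"

definition joint_diophantine_continuous :: "real \<Rightarrow> real^'d^'l \<Rightarrow> bool" where
  "joint_diophantine_continuous \<tau> \<rho> \<longleftrightarrow>
     \<tau> > real (CARD('d) * CARD('l)) - 1 \<and>
     (\<exists>\<alpha>>0. \<forall>k. k \<noteq> 0 \<longrightarrow> \<bar>int_dot k \<rho>\<bar> \<ge> \<alpha> / int_norm1 k powr \<tau>)"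

end

theory Submission
  imports Defs
begin

text \<open>
  Along an orbit of the joint rotation, each component of the product is a quasiperiodic signal: the
  Fourier expansions of the \<open>F j\<close> multiply to an absolutely convergent series of exponentials
  \<open>cis (2 * pi * (int_dot k \<rho> * t))\<close>, indexed by the joint frequencies \<open>k\<close>. The term \<open>k = 0\<close> is the
  constant \<open>\<Prod>j. integral torus (F j)\<close>, and every weighted average reproduces it exactly. Convergence
  at rate \<open>m\<close> therefore amounts to a bound on the weighted averages of the other exponentials that is
  summable against the Fourier coefficients.

  The weight vanishes to infinite order at both ends of \<open>[0, 1]\<close> (\<open>weight_derivatives\<close>). Summing or
  integrating by parts \<open>m\<close> times thus produces no boundary terms, and the average over a time span
  \<open>T\<close> of an exponential of frequency \<open>\<beta>\<close> is at most a constant times \<open>(T * \<delta>) ^ - m\<close>, where \<open>\<delta>\<close>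
  is the distance of \<open>\<beta>\<close> from the resonances, which are the integers in discrete time and \<open>0\<close> in
  continuous time (\<open>weighted_exponential_sum_bound\<close>, \<open>weighted_exponential_integral_bound\<close>). The Diophantine condition
  turns \<open>\<delta> ^ - m\<close> into at most a constant times \<open>int_norm1 k powr (m * \<tau>)\<close>.

  This loss must be paid by the smoothness of the \<open>F j\<close>. The \<open>k\<close>-th Fourier coefficient of a function
  of class \<open>n\<close> is at most a constant times \<open>(1 + norm1 k) ^ - n\<close>, and a power \<open>- s\<close> of \<open>1 + norm1 k\<close>
  is summable over the \<open>d\<close>-dimensional integer lattice as soon as \<open>s > d\<close>. Hence \<open>n > d + m * \<tau>\<close> is
  enough for one function. For given \<open>\<tau>\<close> it is also enough for a product of any number of functions,
  because \<open>int_norm1 k\<close> is at most the product of the \<open>1 + norm1 (k j)\<close>, so that the majorant of the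
  joint series factors over \<open>j\<close> (\<open>averaging_functional_torus_product\<close>).

  Fourier series on the torus are developed as far as this argument needs them. Integration by parts
  rests on the translation invariance of the integral over a period cube
  (\<open>integral_torus_derivative\<close>), and inversion rests on the Stone--Weierstrass theorem
  (\<open>torus_fourier_uniqueness\<close>, \<open>fourier_inversion\<close>).
\<close>

section \<open>The weight and its derivatives\<close>

text \<open>
  The functions \<open>exp (- 1 / x) / x ^ a\<close>, extended by \<open>0\<close> to the left half-line. They are flat at \<open>0\<close>,
  and differentiation maps each of them to a combination of two others.
\<close>
definition flat :: "nat \<Rightarrow> real \<Rightarrow> real" where
  "flat a x = (if 0 < x then exp (- inverse x) * inverse x ^ a else 0)"

text \<open>
  Only \<open>x = 0\<close> is delicate: there the difference quotient from the right is \<open>u ^ Suc a / exp u\<close> with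
  \<open>u = 1 / h\<close>, which tends to \<open>0\<close>.
\<close>
lemma flat_has_derivative:
  "(flat a has_real_derivative (flat (a + 2) x - real a * flat (a + 1) x)) (at x)"
proof -
  consider "x > 0" | "x < 0" | "x = 0" by linarith
  then show ?thesis
  proof cases
    case 1
    have "((\<lambda>x. inverse x ^ a) has_real_derivative - (real a * inverse x ^ (a + 1))) (at x)"
    proof (induction a)
      case (Suc a)
      show ?case
        unfolding power_Suc
        using 1 by (auto intro!: DERIV_cong[OF DERIV_mult[OF DERIV_inverse Suc.IH]]
            simp: algebra_simps power2_eq_square)
    qed (use 1 in simp)
    moreover have "((\<lambda>x. exp (- inverse x)) has_real_derivative (exp (- inverse x) * inverse x ^ 2)) (at x)"
      using 1 by (auto intro!: derivative_eq_intros simp: power2_eq_square)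
    ultimately have "((\<lambda>x. exp (- inverse x) * inverse x ^ a) has_real_derivative
        (exp (- inverse x) * inverse x ^ 2 * inverse x ^ a
         + - (real a * inverse x ^ (a + 1)) * exp (- inverse x))) (at x)"
      by (intro DERIV_mult)
    also have "exp (- inverse x) * inverse x ^ 2 * inverse x ^ a
         + - (real a * inverse x ^ (a + 1)) * exp (- inverse x) = flat (a + 2) x - real a * flat (a + 1) x"
      using 1 by (simp add: flat_def power_add power2_eq_square)
    finally have "((\<lambda>x. exp (- inverse x) * inverse x ^ a) has_real_derivative
        (flat (a + 2) x - real a * flat (a + 1) x)) (at x)" .
    then show ?thesis
      by (rule has_field_derivative_transform_within_open[of _ _ _ "{0<..}"])
         (use 1 in \<open>auto simp: flat_def\<close>)
  next
    case 2
    have "((\<lambda>_. 0) has_real_derivative (flat (a + 2) x - real a * flat (a + 1) x)) (at x)"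
      using 2 by (auto simp: flat_def)
    then show ?thesis
      by (rule has_field_derivative_transform_within_open[of _ _ _ "{..<0}"])
         (use 2 in \<open>auto simp: flat_def\<close>)
  next
    case 3
    have "((\<lambda>h. inverse h ^ Suc a / exp (inverse h)) \<longlongrightarrow> 0) (at_right (0::real))"
      by (rule filterlim_compose[OF tendsto_power_div_exp_0 filterlim_inverse_at_top_right])
    moreover have "\<forall>\<^sub>F h in at_right (0::real).
        inverse h ^ Suc a / exp (inverse h) = (flat a (0 + h) - flat a 0) / h"
      unfolding eventually_at_right_field
      by (intro exI[of _ 1]) (auto simp: flat_def exp_minus field_simps)
    ultimately have r: "((\<lambda>h. (flat a (0 + h) - flat a 0) / h) \<longlongrightarrow> 0) (at_right 0)"
      using tendsto_cong by fast
    have "\<forall>\<^sub>F h in at_left (0::real). 0 = (flat a (0 + h) - flat a 0) / h"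
      unfolding eventually_at_left_field by (intro exI[of _ "-1"]) (auto simp: flat_def)
    then have l: "((\<lambda>h. (flat a (0 + h) - flat a 0) / h) \<longlongrightarrow> 0) (at_left 0)"
      using tendsto_cong tendsto_const by fast
    have "((\<lambda>h. (flat a (0 + h) - flat a 0) / h) \<longlongrightarrow> 0) (at 0)"
      using l r filterlim_at_split by blast
    then have "(flat a has_real_derivative 0) (at 0)"
      by (simp add: DERIV_def)
    then show ?thesis using 3 by (simp add: flat_def)
  qed
qed

text \<open>
  The linear span of the products \<open>flat a x * flat b (1 - x)\<close> contains the weight and is closed under
  differentiation, so it contains all derivatives of the weight.
\<close>
inductive flat_span :: "(real \<Rightarrow> real) \<Rightarrow> bool" where
  prod: "flat_span (\<lambda>x. flat a x * flat b (1 - x))"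
| add: "flat_span f \<Longrightarrow> flat_span g \<Longrightarrow> flat_span (\<lambda>x. f x + g x)"
| scale: "flat_span f \<Longrightarrow> flat_span (\<lambda>x. c * f x)"

lemma flat_span_derivative:
  assumes "flat_span f"
  shows "\<exists>g. flat_span g \<and> (\<forall>x. (f has_real_derivative g x) (at x))"
  using assms
proof induction
  case (prod a b)
  let ?g = "\<lambda>x. (flat (a + 2) x * flat b (1 - x) + (- real a) * (flat (a + 1) x * flat b (1 - x)))
     + ((- 1) * (flat a x * flat (b + 2) (1 - x)) + real b * (flat a x * flat (b + 1) (1 - x)))"
  have "flat_span ?g"
    by (intro flat_span.intros)
  moreover have "((\<lambda>x. flat a x * flat b (1 - x)) has_real_derivative ?g x) (at x)" for x
    by (rule derivative_eq_intros flat_has_derivative DERIV_chain2[OF flat_has_derivative] refl)+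
       (simp add: algebra_simps)
  ultimately show ?case by blast
next
  case (add f g)
  then obtain f' g' where "flat_span f'" "\<And>x. (f has_real_derivative f' x) (at x)"
    "flat_span g'" "\<And>x. (g has_real_derivative g' x) (at x)" by auto
  then show ?case
    by (intro exI[of _ "\<lambda>x. f' x + g' x"] conjI allI flat_span.add DERIV_add)
next
  case (scale f c)
  then obtain f' where "flat_span f'" "\<And>x. (f has_real_derivative f' x) (at x)" by auto
  then show ?case
    by (intro exI[of _ "\<lambda>x. c * f' x"] conjI allI flat_span.scale DERIV_cmult)
qed

lemma flat_span_eq_0:
  assumes "flat_span f" "x \<le> 0 \<or> 1 \<le> x"
  shows "f x = 0"
  using assms by induction (auto simp: flat_def)

definition bump_mass :: real where
  "bump_mass = integral {0..1} (\<lambda>t. exp (- (inverse t * inverse (1 - t))))"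

text \<open>
  By partial fractions, \<open>1 / (x * (1 - x)) = 1 / x + 1 / (1 - x)\<close>.
\<close>
lemma bump_factorization:
  assumes "0 < x" "x < (1::real)"
  shows "exp (- (inverse x * inverse (1 - x))) = flat 0 x * flat 0 (1 - x)"
proof -
  have "inverse x * inverse (1 - x) = inverse x + inverse (1 - x)"
    using assms by (simp add: divide_simps)
  then show ?thesis
    using assms by (simp add: flat_def flip: exp_add)
qed

lemma weight_eq_flat: "weight x = inverse bump_mass * (flat 0 x * flat 0 (1 - x))"
  using bump_factorization[of x]
  by (auto simp: weight_def bump_mass_def flat_def mult.commute)

lemma flat_product_continuous: "continuous_on S (\<lambda>x. flat 0 x * flat 0 (1 - x))"
proof -
  obtain g where "\<And>x. ((\<lambda>x. flat 0 x * flat 0 (1 - x)) has_real_derivative g x) (at x)"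
    using flat_span_derivative[OF flat_span.prod] by blast
  then show ?thesis
    by (meson DERIV_isCont continuous_at_imp_continuous_on)
qed

lemma bump_has_integral:
  "((\<lambda>x. flat 0 x * flat 0 (1 - x)) has_integral bump_mass) {0..1}"
proof -
  have "integral {0..1} (\<lambda>x. flat 0 x * flat 0 (1 - x)) = bump_mass"
    unfolding bump_mass_def
    by (rule integral_spike[of "{0, 1}"]) (simp_all add: bump_factorization)
  then show ?thesis
    using integrable_continuous_interval[OF flat_product_continuous] by (metis integrable_integral)
qed

lemma bump_mass_pos: "bump_mass > 0"
proof -
  have "bump_mass \<ge> 0"
    by (rule has_integral_nonneg[OF bump_has_integral]) (auto simp: flat_def)
  moreover have "bump_mass \<noteq> 0"
  proof
    assume "bump_mass = 0"
    then have "flat 0 (1/2) * flat 0 (1 - 1/2) = 0"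
      using has_integral_0_cbox_imp_0[of 0 1 "\<lambda>x. flat 0 x * flat 0 (1 - x)" "1/2"]
        bump_has_integral flat_product_continuous
      by (auto simp: flat_def)
    then show False by (simp add: flat_def)
  qed
  ultimately show ?thesis by simp
qed

lemma weight_nonneg: "weight x \<ge> 0"
  using bump_mass_pos by (simp add: weight_eq_flat flat_def)

lemma weight_pos: "0 < x \<Longrightarrow> x < 1 \<Longrightarrow> weight x > 0"
  using bump_mass_pos by (simp add: weight_eq_flat flat_def)

lemma weight_has_integral: "(weight has_integral 1) {0..1}"
  using has_integral_mult_right[OF bump_has_integral, of "inverse bump_mass"] bump_mass_pos
  by (simp add: weight_eq_flat[abs_def])

text \<open>
  These properties of the weight produce the rate of convergence: with bounded derivatives of every
  order, all vanishing outside the open unit interval, any number of integrations by parts is possible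
  and none leaves a boundary term.
\<close>
lemma weight_derivatives:
  obtains W where "W 0 = weight"
    and "\<And>n x. (W n has_real_derivative W (Suc n) x) (at x)"
    and "\<And>n x. x \<le> 0 \<or> 1 \<le> x \<Longrightarrow> W n x = 0"
    and "\<And>n. \<exists>B. \<forall>x. \<bar>W n x\<bar> \<le> B"
proof -
  define D where "D f = (SOME g. flat_span g \<and> (\<forall>x. (f has_real_derivative g x) (at x)))"
    for f :: "real \<Rightarrow> real"
  have D: "flat_span (D f)" "\<And>x. (f has_real_derivative D f x) (at x)" if "flat_span f" for f
    using someI_ex[OF flat_span_derivative[OF that], folded D_def] by blast+
  define W where "W n = (D ^^ n) weight" for n
  have span: "flat_span (W n)" for n
  proof (induction n)
    case 0
    have "flat_span (\<lambda>x. inverse bump_mass * (flat 0 x * flat 0 (1 - x)))"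
      by (intro flat_span.intros)
    then show ?case by (simp add: W_def weight_eq_flat[abs_def])
  next
    case (Suc n)
    then show ?case using D by (auto simp: W_def)
  qed
  have der: "(W n has_real_derivative W (Suc n) x) (at x)" for n x
    using D(2)[OF span[of n]] by (simp add: W_def)
  have outside: "W n x = 0" if "x \<le> 0 \<or> 1 \<le> x" for n x
    using flat_span_eq_0[OF span that] .
  have "\<exists>B. \<forall>x. \<bar>W n x\<bar> \<le> B" for n
  proof -
    have "continuous_on {0..1} (W n)"
      by (meson DERIV_isCont der continuous_at_imp_continuous_on)
    then obtain B where B: "\<And>x. x \<in> {0..1} \<Longrightarrow> \<bar>W n x\<bar> \<le> B"
      using compact_imp_bounded[OF compact_continuous_image, of "{0..1}" "W n"]
      by (auto simp: bounded_iff simp del: atLeastAtMost_iff)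
    have "\<bar>W n x\<bar> \<le> max B 0" for x
      using B[of x] outside[of x n] by (cases "x \<in> {0..1}") (auto simp: max_def)
    then show ?thesis by blast
  qed
  with that[of W] der outside show thesis by (auto simp: W_def)
qed

section \<open>Weighted exponential sums and integrals\<close>

text \<open>
  The sine is concave on \<open>[0, pi / 2]\<close> and hence lies above its chord.
\<close>
lemma Jordan_sin:
  assumes "0 \<le> x" "x \<le> pi / 2"
  shows "2 * x / pi \<le> sin x"
proof -
  have "convex_on {0..pi/2} (\<lambda>x. - sin x)"
  proof (rule f''_ge0_imp_convex)
    show "((\<lambda>x. - sin x) has_real_derivative - cos x) (at x)" for x
      by (auto intro!: derivative_eq_intros)
    show "((\<lambda>x. - cos x) has_real_derivative sin x) (at x)" for x
      by (auto intro!: derivative_eq_intros)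
    show "0 \<le> sin x" if "x \<in> {0..pi/2}" for x
      using that by (intro sin_ge_zero) auto
  qed simp
  from convex_onD[OF this, of "2 * x / pi" 0 "pi / 2"] show ?thesis
    using assms by (simp add: field_simps)
qed

lemma cis_add_of_int: "cis (2 * pi * (x + of_int n)) = cis (2 * pi * x)"
proof -
  have "cis (2 * pi * (x + of_int n)) = cis (2 * pi * x) * cis (2 * pi * of_int n)"
    by (simp add: cis_mult algebra_simps)
  then show ?thesis by (simp add: cis_multiple_2pi)
qed

lemma norm_one_minus_cis: "norm (1 - cis (2 * x)) = 2 * \<bar>sin x\<bar>"
proof -
  have "(norm (1 - cis (2 * x)))\<^sup>2 = (1 - cos (2 * x))\<^sup>2 + (sin (2 * x))\<^sup>2"
    by (simp add: cmod_power2)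
  also have "\<dots> = 4 * (sin x)\<^sup>2 * ((sin x)\<^sup>2 + (cos x)\<^sup>2)"
    unfolding cos_double_sin sin_double by algebra
  also have "\<dots> = (2 * \<bar>sin x\<bar>)\<^sup>2"
    by (simp add: power_mult_distrib)
  finally show ?thesis by (rule power2_eq_imp_eq) simp_all
qed

text \<open>
  Summation by parts divides by \<open>1 - cis (2 * pi * \<beta>)\<close>. This small divisor is bounded below by the
  distance from \<open>\<beta>\<close> to the integers.
\<close>
lemma norm_one_minus_cis_ge:
  assumes "\<And>n::int. \<delta> \<le> \<bar>\<beta> - of_int n\<bar>"
  shows "\<delta> \<le> norm (1 - cis (2 * pi * \<beta>))"
proof -
  define y where "y = \<beta> - of_int (round \<beta>)"
  have y: "\<bar>y\<bar> \<le> 1 / 2"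
    using of_int_round_abs_le[of \<beta>] by (simp add: y_def abs_minus_commute)
  have "2 * (pi * \<bar>y\<bar>) / pi \<le> sin (pi * \<bar>y\<bar>)"
    by (rule Jordan_sin) (use y in \<open>auto simp: field_simps\<close>)
  also have "sin (pi * \<bar>y\<bar>) \<le> \<bar>sin (pi * y)\<bar>"
    by (cases "y \<ge> 0") auto
  also have "2 * \<bar>sin (pi * y)\<bar> = norm (1 - cis (2 * pi * y))"
    using norm_one_minus_cis[of "pi * y"] by (simp add: mult.assoc)
  also have "cis (2 * pi * y) = cis (2 * pi * \<beta>)"
    using cis_add_of_int[of y "round \<beta>"] by (simp add: y_def)
  finally have "4 * \<bar>y\<bar> \<le> norm (1 - cis (2 * pi * \<beta>))" by simp
  moreover have "\<delta> \<le> \<bar>y\<bar>" using assms[of "round \<beta>"] by (simp add: y_def)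
  ultimately show ?thesis using abs_ge_zero[of y] by linarith
qed

text \<open>
  The \<open>m\<close>-th backward difference with step \<open>1\<close>. With backward differences the support only grows to
  the right, so that sums over the natural numbers suffice.
\<close>
primrec bdiff :: "nat \<Rightarrow> (real \<Rightarrow> real) \<Rightarrow> real \<Rightarrow> real" where
  "bdiff 0 u = u"
| "bdiff (Suc m) u = bdiff m (\<lambda>x. u x - u (x - 1))"

text \<open>
  By the mean value theorem, one differencing step is controlled by one derivative.
\<close>
lemma abs_bdiff_le:
  assumes "\<And>n x. (U n has_real_derivative U (Suc n) x) (at x)" and "\<And>x. \<bar>U m x\<bar> \<le> B"
  shows "\<bar>bdiff m (U 0) x\<bar> \<le> B"
  using assms
proof (induction m arbitrary: U x)
  case (Suc m)
  define V where "V n x = U n x - U n (x - 1)" for n x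
  have "(V n has_real_derivative V (Suc n) x) (at x)" for n x
    unfolding V_def
    by (rule derivative_eq_intros Suc.prems(1) DERIV_chain2[OF Suc.prems(1)] refl)+ simp
  moreover have "\<bar>V m x\<bar> \<le> B" for x
  proof -
    obtain z where "U m x - U m (x - 1) = (x - (x - 1)) * U (Suc m) z"
      using MVT2[of "x - 1" x "U m" "U (Suc m)"] Suc.prems(1) by auto
    then show ?thesis using Suc.prems(2)[of z] by (simp add: V_def)
  qed
  ultimately have "\<bar>bdiff m (V 0) x\<bar> \<le> B" by (rule Suc.IH)
  then show ?case by (simp add: V_def[abs_def])
qed simp

text \<open>
  Summation by parts. The boundary terms vanish as long as the range of summation covers the support
  \<open>(0, R + m)\<close> of all differences involved.
\<close>
lemma sum_bdiff_mult_power: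
  fixes q :: complex
  assumes "\<And>x. x \<le> 0 \<or> R \<le> x \<Longrightarrow> u x = 0" and "R + real m \<le> real K"
  shows "(1 - q) ^ m * (\<Sum>n<K. of_real (u (real n)) * q ^ n)
       = (\<Sum>n<K. of_real (bdiff m u (real n)) * q ^ n)"
  using assms
proof (induction m arbitrary: u R)
  case (Suc m)
  show ?case
  proof (cases K)
    case (Suc k)
    define v where "v x = u x - u (x - 1)" for x
    have "(\<Sum>n<K. of_real (v (real n)) * q ^ n)
        = (\<Sum>n<K. of_real (u (real n)) * q ^ n) - (\<Sum>n<K. of_real (u (real n - 1)) * q ^ n)"
      by (simp add: v_def algebra_simps sum_subtractf)
    also have "(\<Sum>n<K. of_real (u (real n - 1)) * q ^ n) = q * (\<Sum>n<k. of_real (u (real n)) * q ^ n)"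
      using Suc.prems(1)[of "-1"] unfolding Suc sum.lessThan_Suc_shift
      by (simp add: sum_distrib_left algebra_simps)
    also have "(\<Sum>n<k. of_real (u (real n)) * q ^ n) = (\<Sum>n<K. of_real (u (real n)) * q ^ n)"
      using Suc.prems(1)[of "real k"] Suc.prems(2) Suc by simp
    finally have "(1 - q) * (\<Sum>n<K. of_real (u (real n)) * q ^ n)
        = (\<Sum>n<K. of_real (v (real n)) * q ^ n)"
      by (simp add: algebra_simps)
    moreover have "(1 - q) ^ m * (\<Sum>n<K. of_real (v (real n)) * q ^ n)
       = (\<Sum>n<K. of_real (bdiff m v (real n)) * q ^ n)"
      by (rule Suc.IH[of "R + 1"]) (use Suc.prems in \<open>auto simp: v_def\<close>)
    ultimately show ?thesis
      by (simp add: v_def[abs_def] power_Suc2 mult.assoc del: power_Suc)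
  qed simp
qed simp

text \<open>
  A crude linear lower bound suffices: at least an eighth of the sampling points lie in \<open>[1/4, 1/2]\<close>,
  where the weight has a positive minimum.
\<close>
lemma weight_sum_ge:
  obtains a where "a > 0" and "\<And>N. 4 \<le> N \<Longrightarrow> a * real N \<le> weight_sum N"
proof -
  have cont: "continuous_on {1/4..1/2} weight"
    using continuous_on_mult_left[OF flat_product_continuous, of _ "inverse bump_mass"]
    by (simp add: weight_eq_flat[abs_def])
  obtain x0 where x0: "x0 \<in> {1/4..1/2}" "\<And>x. x \<in> {1/4..1/2} \<Longrightarrow> weight x0 \<le> weight x"
    using continuous_attains_inf[OF _ _ cont] by auto
  have pos: "weight x0 > 0" using x0(1) by (intro weight_pos) auto
  show thesis
  proof (rule that)
    show "weight x0 / 8 > 0" using pos by simp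
    fix N :: nat assume "4 \<le> N"
    \<comment> \<open>The points \<open>n / N\<close> with \<open>q < n \<le> 2 * q\<close> lie in \<open>[1/4, 1/2]\<close>, and \<open>q \<ge> N / 8\<close>.\<close>
    define q where "q = N div 4"
    have q: "1 \<le> q" "4 * q \<le> N" "N < 4 * q + 4"
      using \<open>4 \<le> N\<close> by (auto simp: q_def)
    have "weight x0 / 8 * real N \<le> weight x0 * real q"
      using q pos by (simp add: field_simps)
    also have "\<dots> = (\<Sum>n\<in>{q+1..2*q}. weight x0)" by simp
    also have "\<dots> \<le> (\<Sum>n\<in>{q+1..2*q}. weight (real n / real N))"
      by (intro sum_mono x0(2)) (use q in \<open>auto simp: field_simps\<close>)
    also have "\<dots> \<le> weight_sum N"
      unfolding weight_sum_def
      by (rule sum_mono2) (use q in \<open>auto intro: weight_nonneg\<close>)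
    finally show "weight x0 / 8 * real N \<le> weight_sum N" .
  qed
qed

text \<open>
  Summing by parts \<open>m\<close> times gains a factor \<open>N ^ - m\<close> from the differences of \<open>weight (x / N)\<close> and
  costs a factor \<open>\<delta> ^ - m\<close> from the small divisor. The remaining sum has at most \<open>(1 + m) * N\<close> terms,
  which the normalization by \<open>weight_sum N\<close> absorbs.
\<close>
lemma weighted_exponential_sum_bound:
  obtains C where "C \<ge> 0"
    and "\<And>N \<beta> \<delta>. 4 \<le> N \<Longrightarrow> 0 < \<delta> \<Longrightarrow> (\<And>n::int. \<delta> \<le> \<bar>\<beta> - of_int n\<bar>) \<Longrightarrow>
      norm ((1 / weight_sum N) *\<^sub>R
        (\<Sum>n<N. weight (real n / real N) *\<^sub>R cis (2 * pi * (\<beta> * real n))))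
      \<le> C / real N ^ m / \<delta> ^ m"
proof -
  obtain W where W: "W 0 = weight" "\<And>n x. (W n has_real_derivative W (Suc n) x) (at x)"
    "\<And>n x. x \<le> 0 \<or> 1 \<le> x \<Longrightarrow> W n x = 0" "\<And>n. \<exists>B. \<forall>x. \<bar>W n x\<bar> \<le> B"
    using weight_derivatives by blast
  obtain B where B: "\<And>x. \<bar>W m x\<bar> \<le> B" using W(4)[of m] by blast
  have "B \<ge> 0" using B[of 0] by linarith
  obtain a where a: "a > 0" "\<And>N. 4 \<le> N \<Longrightarrow> a * real N \<le> weight_sum N"
    using weight_sum_ge by blast
  show thesis
  proof (rule that)
    show "(1 + real m) * B / a \<ge> 0" using \<open>B \<ge> 0\<close> a by simp
    fix N :: nat and \<beta> \<delta> :: real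
    assume N: "4 \<le> N" and \<delta>: "0 < \<delta>" "\<And>n::int. \<delta> \<le> \<bar>\<beta> - of_int n\<bar>"
    define q where "q = cis (2 * pi * \<beta>)"
    define U where "U n x = W n (x / real N) / real N ^ n" for n x
    define S where "S = (\<Sum>n<N. weight (real n / real N) *\<^sub>R cis (2 * pi * (\<beta> * real n)))"
    have "S = (\<Sum>n<N. of_real (U 0 (real n)) * q ^ n)"
      unfolding S_def q_def U_def W(1) Complex.DeMoivre scaleR_conv_of_real
      by (intro sum.cong) (auto simp: mult_ac)
    also have "\<dots> = (\<Sum>n<N+m. of_real (U 0 (real n)) * q ^ n)"
      by (rule sum.mono_neutral_left) (use N in \<open>auto simp: U_def W(3)\<close>)
    finally have "(1 - q) ^ m * S = (\<Sum>n<N+m. of_real (bdiff m (U 0) (real n)) * q ^ n)"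
      using sum_bdiff_mult_power[of "real N" "U 0" m "N + m" q] N by (auto simp: U_def W(3) field_simps)
    moreover have "\<bar>bdiff m (U 0) x\<bar> \<le> B / real N ^ m" for x
    proof (rule abs_bdiff_le)
      show "(U n has_real_derivative U (Suc n) x) (at x)" for n x
        unfolding U_def
        by (rule DERIV_cong[OF DERIV_cdivide[OF DERIV_chain2[OF W(2) DERIV_cdivide[OF DERIV_ident]]]])
             simp
      show "\<bar>U m x\<bar> \<le> B / real N ^ m" for x
        using B[of "x / real N"] N by (simp add: U_def divide_right_mono)
    qed
    ultimately have "norm ((1 - q) ^ m * S) \<le> (\<Sum>n<N+m. B / real N ^ m)"
      by (auto intro!: sum_norm_le simp: norm_mult norm_power q_def simp del: sum_constant)
    also have "\<dots> \<le> (1 + real m) * real N * (B / real N ^ m)"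
    proof -
      have "real m * 1 \<le> real m * real N" using N by (intro mult_left_mono) auto
      then have "real (N + m) \<le> (1 + real m) * real N" by (simp add: algebra_simps)
      then have "real (N + m) * (B / real N ^ m) \<le> (1 + real m) * real N * (B / real N ^ m)"
        using \<open>B \<ge> 0\<close> by (intro mult_right_mono) auto
      then show ?thesis by simp
    qed
    finally have 1: "norm (1 - q) ^ m * norm S \<le> (1 + real m) * real N * (B / real N ^ m)"
      by (simp add: norm_mult norm_power)
    have "\<delta> ^ m * norm S \<le> norm (1 - q) ^ m * norm S"
      using \<delta> norm_one_minus_cis_ge[of \<delta> \<beta>] unfolding q_def
      by (intro mult_right_mono power_mono) auto
    with 1 have "norm S * \<delta> ^ m \<le> (1 + real m) * real N * (B / real N ^ m)"
      by (simp add: mult.commute)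
    then have 2: "norm S \<le> (1 + real m) * real N * (B / real N ^ m) / \<delta> ^ m"
      using \<delta>(1) by (intro mult_imp_le_div_pos) auto
    have "weight_sum N > 0"
      using a(1) a(2)[OF N] N by (smt (verit) mult_pos_pos of_nat_0_less_iff zero_less_numeral order_less_le_trans)
    then have "norm ((1 / weight_sum N) *\<^sub>R S) = norm S / weight_sum N"
      by simp
    also have "\<dots> \<le> norm S / (a * real N)"
      using a(1) a(2)[OF N] N by (intro divide_left_mono) (auto intro!: mult_pos_pos \<open>weight_sum N > 0\<close>)
    also have "\<dots> \<le> (1 + real m) * real N * (B / real N ^ m) / \<delta> ^ m / (a * real N)"
      using 2 a(1) by (intro divide_right_mono) auto
    also have "\<dots> = (1 + real m) * B / a / real N ^ m / \<delta> ^ m"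
      using a(1) N \<delta> by (simp add: field_simps)
    finally show "norm ((1 / weight_sum N) *\<^sub>R S) \<le> (1 + real m) * B / a / real N ^ m / \<delta> ^ m" .
  qed
qed

text \<open>
  The continuous analogue: each integration by parts gains a factor \<open>1 / (T * \<beta>)\<close>.
\<close>
lemma weighted_exponential_integral_bound:
  obtains C where "C \<ge> 0"
    and "\<And>T \<beta> \<delta>. 0 < T \<Longrightarrow> 0 < \<delta> \<Longrightarrow> \<delta> \<le> \<bar>\<beta>\<bar> \<Longrightarrow>
      norm ((1 / T) *\<^sub>R integral {0..T} (\<lambda>s. weight (s / T) *\<^sub>R cis (2 * pi * (\<beta> * s))))
      \<le> C / T ^ m / \<delta> ^ m"
proof -
  obtain W where W: "W 0 = weight" "\<And>n x. (W n has_real_derivative W (Suc n) x) (at x)"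
    "\<And>n x. x \<le> 0 \<or> 1 \<le> x \<Longrightarrow> W n x = 0" "\<And>n. \<exists>B. \<forall>x. \<bar>W n x\<bar> \<le> B"
    using weight_derivatives by blast
  obtain B where B: "\<And>x. \<bar>W m x\<bar> \<le> B" using W(4)[of m] by blast
  have "B \<ge> 0" using B[of 0] by linarith
  have contW: "continuous_on S (W n)" for S n
    by (meson DERIV_isCont W(2) continuous_at_imp_continuous_on)
  show thesis
  proof (rule that[OF \<open>B \<ge> 0\<close>])
    fix T \<beta> \<delta> :: real assume T: "0 < T" and \<delta>: "0 < \<delta>" "\<delta> \<le> \<bar>\<beta>\<bar>"
    define c where "c = 2 * pi * \<beta>"
    define f where "f n s = W n (s / T) *\<^sub>R cis (c * s)" for n s
    define J where "J n = integral {0..T} (f n)" for n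
    have contf: "continuous_on {0..T} (f n)" for n
      unfolding f_def using T by (intro continuous_intros continuous_on_compose2[OF contW]) auto
    have int: "(f n has_integral J n) {0..T}" for n
      unfolding J_def using integrable_continuous_interval[OF contf] by (rule integrable_integral)
    have step: "J (Suc n) = - (of_real T * (\<i> * of_real c)) * J n" for n
    proof -
      have "((\<lambda>s. (1 / T) *\<^sub>R f (Suc n) s + (\<i> * of_real c) * f n s) has_integral (f n T - f n 0)) {0..T}"
      proof (rule fundamental_theorem_of_calculus)
        fix s assume "s \<in> {0..T}"
        have "((\<lambda>s. exp (\<i> * of_real c * of_real s)) has_vector_derivative
            (\<i> * of_real c * exp (\<i> * of_real c * of_real s))) (at s within {0..T})"
          by (rule has_vector_derivative_real_field[of "\<lambda>z. exp (\<i> * of_real c * z)"])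
             (auto intro!: derivative_eq_intros)
        then have "((\<lambda>s. cis (c * s)) has_vector_derivative (\<i> * of_real c * cis (c * s))) (at s within {0..T})"
          by (simp add: cis_conv_exp mult.assoc)
        moreover have "((\<lambda>s. W n (s / T)) has_real_derivative (W (Suc n) (s / T) / T)) (at s within {0..T})"
          by (rule DERIV_subset[OF _ subset_UNIV])
             (rule DERIV_cong[OF DERIV_chain2[OF W(2) DERIV_cdivide[OF DERIV_ident]]], simp)
        ultimately have "(f n has_vector_derivative W n (s / T) *\<^sub>R (\<i> * of_real c * cis (c * s))
            + (W (Suc n) (s / T) / T) *\<^sub>R cis (c * s)) (at s within {0..T})"
          unfolding f_def by (intro has_vector_derivative_scaleR)
        also have "W n (s / T) *\<^sub>R (\<i> * of_real c * cis (c * s)) + (W (Suc n) (s / T) / T) *\<^sub>R cis (c * s)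
            = (1 / T) *\<^sub>R f (Suc n) s + (\<i> * of_real c) * f n s"
          by (simp add: f_def scaleR_conv_of_real)
        finally show "(f n has_vector_derivative (1 / T) *\<^sub>R f (Suc n) s + (\<i> * of_real c) * f n s)
            (at s within {0..T})" .
      qed (use T in simp)
      moreover have "f n T = 0" "f n 0 = 0"
        using T by (auto simp: f_def W(3))
      ultimately have "((\<lambda>s. (1 / T) *\<^sub>R f (Suc n) s + (\<i> * of_real c) * f n s) has_integral 0) {0..T}"
        by simp
      moreover have "((\<lambda>s. (1 / T) *\<^sub>R f (Suc n) s + (\<i> * of_real c) * f n s) has_integral
          ((1 / T) *\<^sub>R J (Suc n) + (\<i> * of_real c) * J n)) {0..T}"
        by (intro has_integral_add has_integral_cmul has_integral_mult_right int)
      ultimately have "(1 / T) *\<^sub>R J (Suc n) + (\<i> * of_real c) * J n = 0"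
        using has_integral_unique by blast
      then have "of_real T * ((1 / T) *\<^sub>R J (Suc n) + (\<i> * of_real c) * J n) = 0"
        by simp
      then show ?thesis
        using T by (simp add: scaleR_conv_of_real algebra_simps eq_neg_iff_add_eq_0)
    qed
    have iter: "norm (J n) = (T * \<bar>c\<bar>) ^ n * norm (J 0)" for n
      by (induction n) (use T in \<open>auto simp: step norm_mult\<close>)
    have "norm (J m) \<le> B * T"
    proof -
      have "norm (f m s) \<le> B" for s
        using B[of "s / T"] by (simp add: f_def)
      then show ?thesis
        using has_integral_bound_real[of B "{}" "f m" "J m" 0 T] int[of m] \<open>B \<ge> 0\<close> T
        by (auto simp: content_real)
    qed
    then have "(T * \<bar>c\<bar>) ^ m * norm (J 0) \<le> B * T" using iter[of m] by simp
    moreover have "(T * \<delta>) ^ m * norm (J 0) \<le> (T * \<bar>c\<bar>) ^ m * norm (J 0)"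
    proof -
      have "1 * \<bar>\<beta>\<bar> \<le> 2 * pi * \<bar>\<beta>\<bar>"
        using pi_gt3 by (intro mult_right_mono) auto
      then have "\<delta> \<le> \<bar>c\<bar>" using \<delta>(2) unfolding c_def by (simp add: abs_mult)
      then show ?thesis using T \<delta> by (intro mult_right_mono power_mono mult_left_mono) auto
    qed
    ultimately have "(T * \<delta>) ^ m * norm (J 0) \<le> B * T" by linarith
    then have "norm ((1 / T) *\<^sub>R J 0) \<le> B / T ^ m / \<delta> ^ m"
      using T \<delta> by (simp add: field_simps power_mult_distrib)
    moreover have "J 0 = integral {0..T} (\<lambda>s. weight (s / T) *\<^sub>R cis (2 * pi * (\<beta> * s)))"
      by (simp add: J_def f_def[abs_def] W(1) c_def mult.assoc)
    ultimately show "norm ((1 / T) *\<^sub>R integral {0..T} (\<lambda>s. weight (s / T) *\<^sub>R cis (2 * pi * (\<beta> * s))))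
        \<le> B / T ^ m / \<delta> ^ m" by simp
  qed
qed

section \<open>Integration of periodic functions over the torus\<close>

lemma torus_eq_cbox: "torus = cbox 0 1"
  by (auto simp: torus_def mem_box_cart)

lemma torus_periodic_of_int:
  assumes "torus_periodic f"
  shows "f (x + of_int n *\<^sub>R axis i 1) = f x"
proof -
  have nat: "f (x + of_nat m *\<^sub>R axis i 1) = f x" for m x
  proof (induction m arbitrary: x)
    case (Suc m)
    have "x + of_nat (Suc m) *\<^sub>R axis i 1 = (x + of_nat m *\<^sub>R axis i 1) + axis i 1"
      by (simp add: algebra_simps)
    then show ?case using Suc assms by (simp only: torus_periodic_def)
  qed simp
  show ?thesis
  proof (cases "n \<ge> 0")
    case True
    then show ?thesis using nat[where m = "nat n"] by simp
  next
    case False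
    then show ?thesis
      using nat[where m = "nat (- n)" and x = "x + of_int n *\<^sub>R axis i 1"] by simp
  qed
qed

lemma torus_periodic_lattice:
  fixes f :: "real^'d \<Rightarrow> 'b"
  assumes "torus_periodic f" and "\<And>i. a $ i \<in> \<int>"
  shows "f (x + a) = f x"
proof -
  have "f (x + (\<Sum>i\<in>I. (a $ i) *\<^sub>R axis i 1)) = f x" if "finite I" for I
    using that
  proof induction
    case (insert i I)
    obtain n where "a $ i = of_int n" using assms(2)[of i] by (auto elim: Ints_cases)
    then show ?case
      using insert torus_periodic_of_int[OF assms(1), of "x + (\<Sum>i\<in>I. (a $ i) *\<^sub>R axis i 1)" n i]
      by (simp add: algebra_simps)
  qed simp
  from this[of UNIV] show ?thesis
    using basis_expansion[of a] by (simp add: scalar_mult_eq_scaleR)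
qed

lemma torus_periodic_rotation:
  assumes "torus_periodic f"
  shows "f (rotation r s \<theta>) = f (\<theta> + s *\<^sub>R r)"
proof -
  have "f (rotation r s \<theta> + (\<chi> i. of_int \<lfloor>\<theta> $ i + s * r $ i\<rfloor>)) = f (rotation r s \<theta>)"
    by (rule torus_periodic_lattice[OF assms]) simp
  moreover have "rotation r s \<theta> + (\<chi> i. of_int \<lfloor>\<theta> $ i + s * r $ i\<rfloor>) = \<theta> + s *\<^sub>R r"
    by (simp add: vec_eq_iff rotation_def frac_def)
  ultimately show ?thesis by simp
qed

text \<open>
  The translated cube is cut by a hyperplane orthogonal to the direction of translation. One piece
  already lies in the unit cube, and a shift by one period moves the other piece onto the missing part.
\<close>
lemma integral_torus_translate:
  fixes f :: "real^'d \<Rightarrow> 'b::{real_normed_vector,banach}"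
  assumes per: "torus_periodic f" and cont: "continuous_on UNIV f" and t: "0 \<le> t" "t \<le> 1"
  shows "integral torus (\<lambda>x. f (x + t *\<^sub>R axis i 1)) = integral torus f"
proof -
  define e :: "real^'d" where "e = axis i 1"
  define b :: "real^'d" where "b = (\<chi> j. if j = i then t else 1)"
  have e: "e \<in> Basis" "e $ i = 1" "\<And>j. j \<noteq> i \<Longrightarrow> e $ j = 0" "\<And>x. x \<bullet> e = x $ i"
    by (auto simp: e_def Basis_vec_def inner_axis) (auto simp: axis_def)
  have mem: "x \<in> cbox u v \<longleftrightarrow>
      (u $ i \<le> x $ i \<and> x $ i \<le> v $ i) \<and> (\<forall>j. j \<noteq> i \<longrightarrow> u $ j \<le> x $ j \<and> x $ j \<le> v $ j)"
    for x u v :: "real^'d"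
    unfolding mem_box_cart by metis
  have int: "f integrable_on cbox u v" for u v
    by (intro integrable_continuous continuous_on_subset[OF cont]) auto
  have "integral torus (\<lambda>x. f (x + t *\<^sub>R e)) = integral (cbox (t *\<^sub>R e) (1 + t *\<^sub>R e)) f"
    using integral_shift_cbox_plus[of 0 1 f "t *\<^sub>R e"]
    by (simp add: torus_eq_cbox o_def add.commute)
  also have "\<dots> = integral (cbox (t *\<^sub>R e) (1 + t *\<^sub>R e) \<inter> {x. x \<bullet> e \<le> 1}) f
               + integral (cbox (t *\<^sub>R e) (1 + t *\<^sub>R e) \<inter> {x. x \<bullet> e \<ge> 1}) f"
    by (rule integral_split[OF int e(1)])
  also have "cbox (t *\<^sub>R e) (1 + t *\<^sub>R e) \<inter> {x. x \<bullet> e \<le> 1} = torus \<inter> {x. x \<bullet> e \<ge> t}"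
    using t by (auto simp: mem torus_eq_cbox e(2-4) b_def)
  also have "cbox (t *\<^sub>R e) (1 + t *\<^sub>R e) \<inter> {x. x \<bullet> e \<ge> 1} = cbox (0 + e) (b + e)"
    using t by (auto simp: mem torus_eq_cbox e(2-4) b_def)
  also have "integral (cbox (0 + e) (b + e)) f = integral (cbox 0 b) f"
    using integral_shift_cbox_plus[of 0 b f e] per
    by (simp add: o_def torus_periodic_def e_def add.commute)
  also have "cbox 0 b = torus \<inter> {x. x \<bullet> e \<le> t}"
    using t by (auto simp: mem torus_eq_cbox e(2-4) b_def)
  also have "integral (torus \<inter> {x. x \<bullet> e \<ge> t}) f + integral (torus \<inter> {x. x \<bullet> e \<le> t}) f = integral torus f"
    unfolding torus_eq_cbox using integral_split[OF int e(1), of 0 1 t] by simp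
  finally show ?thesis by (simp add: e_def)
qed

text \<open>
  By translation invariance, \<open>t \<mapsto> integral torus (\<lambda>x. g (x + t *\<^sub>R axis i 1))\<close> is constant;
  differentiating it under the integral sign gives the claim. This replaces integration by parts in the
  \<open>i\<close>-th coordinate, and no iterated integrals are needed.
\<close>
lemma integral_torus_derivative:
  fixes g g' :: "real^'d \<Rightarrow> 'b::banach"
  assumes per: "torus_periodic g" and cont: "continuous_on UNIV g" "continuous_on UNIV g'"
    and der: "\<And>x. ((\<lambda>t. g (x + t *\<^sub>R axis i 1)) has_vector_derivative g' x) (at 0)"
  shows "integral torus g' = 0"
proof -
  have der_t: "((\<lambda>s. g (x + s *\<^sub>R axis i 1)) has_vector_derivative g' (x + t *\<^sub>R axis i 1)) (at t)" for x t
  proof -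
    have "((\<lambda>s. s - t) has_vector_derivative 1) (at t)"
      by (auto intro!: derivative_eq_intros)
    from vector_diff_chain_at[OF this, of "\<lambda>s. g (x + t *\<^sub>R axis i 1 + s *\<^sub>R axis i 1)"]
    show ?thesis using der[of "x + t *\<^sub>R axis i 1"] by (simp add: o_def algebra_simps)
  qed
  have "((\<lambda>t. integral (cbox 0 1) (\<lambda>x. g (x + t *\<^sub>R axis i 1))) has_vector_derivative
      integral (cbox 0 1) (\<lambda>x. g' (x + 0 *\<^sub>R axis i 1))) (at 0 within {0..1})"
  proof (rule leibniz_rule_vector_derivative)
    show "((\<lambda>s. g (x + s *\<^sub>R axis i 1)) has_vector_derivative g' (x + t *\<^sub>R axis i 1)) (at t within {0..1})"
      for x t using der_t by (rule has_vector_derivative_at_within)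
    show "(\<lambda>x. g (x + t *\<^sub>R axis i 1)) integrable_on cbox 0 1" for t
      by (intro integrable_continuous continuous_on_compose2[OF cont(1)] continuous_intros) auto
    show "continuous_on ({0..1} \<times> cbox 0 1) (\<lambda>(t, x). g' (x + t *\<^sub>R axis i 1))"
      unfolding split_beta by (intro continuous_on_compose2[OF cont(2)] continuous_intros) auto
  qed auto
  then have "((\<lambda>t. integral torus (\<lambda>x. g (x + t *\<^sub>R axis i 1))) has_vector_derivative
      integral torus g') (at 0 within {0..1})"
    by (simp add: torus_eq_cbox)
  then have "((\<lambda>t. integral torus g) has_vector_derivative integral torus g') (at 0 within {0..1})"
    by (rule has_vector_derivative_transform[rotated 2])
       (simp_all add: integral_torus_translate[OF per cont(1)])
  then show ?thesis
    using vector_derivative_unique_within_closed_interval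
        [OF zero_less_one _ _ has_vector_derivative_const, of 0 "integral torus g" "integral torus g'"]
    by simp
qed

section \<open>Fourier coefficients and their decay\<close>

definition character :: "int^'d \<Rightarrow> real^'d \<Rightarrow> complex" where
  "character k x = cis (2 * pi * (\<Sum>i\<in>UNIV. of_int (k $ i) * x $ i))"

lemma norm_character [simp]: "norm (character k x) = 1"
  by (simp add: character_def)

lemma character_add_index: "character (k + l) x = character k x * character l x"
  by (simp add: character_def cis_mult sum.distrib algebra_simps)

lemma character_add: "character k (x + y) = character k x * character k y"
  by (simp add: character_def cis_mult sum.distrib algebra_simps)

lemma character_0 [simp]: "character 0 = (\<lambda>x. 1)"
  by (simp add: character_def fun_eq_iff)

lemma character_scaleR_axis:
  "character k (t *\<^sub>R axis i 1) = cis (2 * pi * (of_int (k $ i) * t))"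
proof -
  have "(\<Sum>j\<in>UNIV. of_int (k $ j) * (t *\<^sub>R axis i (1::real)) $ j)
      = (\<Sum>j\<in>UNIV. if j = i then of_int (k $ j) * t else 0)"
    by (intro sum.cong) (auto simp: axis_def)
  then show ?thesis by (simp add: character_def)
qed

lemma torus_periodic_character: "torus_periodic (character k)"
  using character_scaleR_axis[of k 1]
  by (simp add: torus_periodic_def character_add cis_multiple_2pi)

lemma continuous_on_character [continuous_intros]:
  "continuous_on S f \<Longrightarrow> continuous_on S (\<lambda>x. character k (f x))"
  unfolding character_def cis_conv_exp by (intro continuous_intros)

lemma character_axis_derivative:
  "((\<lambda>t. character k (x + t *\<^sub>R axis i 1)) has_vector_derivative
      (2 * pi * \<i> * of_int (k $ i)) * character k x) (at 0)"
proof -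
  have "((\<lambda>t. exp (2 * pi * \<i> * of_int (k $ i) * of_real t)) has_vector_derivative
      (2 * pi * \<i> * of_int (k $ i)) * exp (2 * pi * \<i> * of_int (k $ i) * of_real 0)) (at 0)"
    by (rule has_vector_derivative_real_field[of "\<lambda>z. exp (2 * pi * \<i> * of_int (k $ i) * z)"])
       (auto intro!: derivative_eq_intros)
  then have "((\<lambda>t. character k (t *\<^sub>R axis i 1)) has_vector_derivative (2 * pi * \<i> * of_int (k $ i))) (at 0)"
    by (simp add: character_scaleR_axis cis_conv_exp mult_ac)
  from has_vector_derivative_mult_right[OF this, of "character k x"] show ?thesis
    by (simp add: character_add mult_ac)
qed

definition fourier_coeff :: "(real^'d \<Rightarrow> complex) \<Rightarrow> int^'d \<Rightarrow> complex" where
  "fourier_coeff f k = integral torus (\<lambda>x. f x * character (- k) x)"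

lemma integrable_on_torus:
  fixes f :: "real^'d \<Rightarrow> 'b::banach"
  shows "continuous_on UNIV f \<Longrightarrow> f integrable_on torus"
  unfolding torus_eq_cbox by (blast intro: integrable_continuous continuous_on_subset)

lemma integral_torus_const: "integral (torus :: (real^'d) set) (\<lambda>x. c) = (c :: 'b::banach)"
proof -
  have "measure lborel (cbox 0 (1::real^'d)) = 1"
    by (subst content_cbox_cart) (auto simp: interval_ne_empty_cart)
  then show ?thesis by (simp add: torus_eq_cbox)
qed

text \<open>
  For \<open>k \<noteq> 0\<close> some derivative of the character is a nonzero multiple of the character itself, and a
  derivative integrates to \<open>0\<close>.
\<close>
lemma integral_character: "integral torus (character k) = (if k = 0 then 1 else 0)"
proof (cases "k = 0")
  case False
  then obtain i where i: "k $ i \<noteq> 0" by (auto simp: vec_eq_iff)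
  have "integral torus (\<lambda>x. (2 * pi * \<i> * of_int (k $ i)) * character k x) = 0"
    by (rule integral_torus_derivative[OF torus_periodic_character _ _ character_axis_derivative])
       (intro continuous_intros)+
  then show ?thesis using i False by (simp add: integral_mult_right)
qed (simp add: integral_torus_const)

lemma norm_integral_torus_le:
  fixes f :: "real^'d \<Rightarrow> 'b::banach"
  assumes "continuous_on UNIV f" "\<And>x. x \<in> torus \<Longrightarrow> norm (f x) \<le> B"
  shows "norm (integral torus f) \<le> B"
  using integral_norm_bound_integral[OF integrable_on_torus[OF assms(1)], of "\<lambda>_. B"] assms(2)
    integrable_on_torus[of "\<lambda>_. B"] by (simp add: integral_torus_const)

lemma fourier_coeff_diff:
  assumes "continuous_on UNIV f" "continuous_on UNIV g"
  shows "fourier_coeff (\<lambda>x. f x - g x) k = fourier_coeff f k - fourier_coeff g k"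
  unfolding fourier_coeff_def left_diff_distrib
  by (intro integral_diff integrable_on_torus continuous_intros assms)

lemma fourier_coeff_add:
  assumes "continuous_on UNIV f" "continuous_on UNIV g"
  shows "fourier_coeff (\<lambda>x. f x + g x) k = fourier_coeff f k + fourier_coeff g k"
  unfolding fourier_coeff_def distrib_right
  by (intro integral_add integrable_on_torus continuous_intros assms)

lemma fourier_coeff_sum:
  assumes "finite A" "\<And>a. a \<in> A \<Longrightarrow> continuous_on UNIV (f a)"
  shows "fourier_coeff (\<lambda>x. \<Sum>a\<in>A. f a x) k = (\<Sum>a\<in>A. fourier_coeff (f a) k)"
  unfolding fourier_coeff_def sum_distrib_right
  by (intro integral_sum integrable_on_torus continuous_intros assms)

lemma fourier_coeff_cmult: "fourier_coeff (\<lambda>x. c * f x) k = c * fourier_coeff f k"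
  by (simp add: fourier_coeff_def mult.assoc integral_mult_right)

lemma fourier_coeff_mult_character:
  "fourier_coeff (\<lambda>x. f x * character l x) k = fourier_coeff f (k - l)"
  by (simp add: fourier_coeff_def mult.assoc character_add_index[symmetric])

lemma cont_diff_continuous: "cont_diff n f \<Longrightarrow> continuous_on UNIV f"
  by (cases n) (auto intro: differentiable_imp_continuous_on)

text \<open>
  The derivative of \<open>f x * character (- k) x\<close> along the \<open>i\<close>-th axis integrates to \<open>0\<close>.
\<close>
lemma fourier_coeff_derivative:
  assumes per: "torus_periodic f" and diff: "f differentiable_on UNIV"
    and cont: "continuous_on UNIV (\<lambda>x. frechet_derivative f (at x) (axis i 1))"
  shows "fourier_coeff (\<lambda>x. frechet_derivative f (at x) (axis i 1)) k
       = 2 * pi * \<i> * of_int (k $ i) * fourier_coeff f k"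
proof -
  define D where "D x = frechet_derivative f (at x) (axis i 1)" for x
  have contf: "continuous_on UNIV f" using diff by (rule differentiable_imp_continuous_on)
  have der: "((\<lambda>t. f (x + t *\<^sub>R axis i 1)) has_vector_derivative D x) (at 0)" for x
  proof -
    have f': "(f has_derivative frechet_derivative f (at x)) (at x)"
      using diff by (simp add: differentiable_on_def frechet_derivative_works)
    have "((\<lambda>t. x + t *\<^sub>R axis i 1) has_derivative (\<lambda>t. t *\<^sub>R axis i 1)) (at 0)"
      by (auto intro!: derivative_eq_intros)
    then have "((\<lambda>t. f (x + t *\<^sub>R axis i 1)) has_derivative
        (\<lambda>t. frechet_derivative f (at x) (t *\<^sub>R axis i 1))) (at 0)"
      by (rule has_derivative_compose) (use f' in simp)
    moreover have "frechet_derivative f (at x) (t *\<^sub>R axis i 1) = t *\<^sub>R D x" for t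
      using has_derivative_linear[OF f'] by (simp add: D_def linear_scale)
    ultimately show ?thesis by (simp add: has_vector_derivative_def)
  qed
  have "integral torus (\<lambda>x. f x * ((2 * pi * \<i> * of_int ((- k) $ i)) * character (- k) x)
      + D x * character (- k) x) = 0"
  proof (rule integral_torus_derivative)
    show "torus_periodic (\<lambda>x. f x * character (- k) x)"
      using per torus_periodic_character[of "- k"] by (simp add: torus_periodic_def)
    show "((\<lambda>t. f (x + t *\<^sub>R axis i 1) * character (- k) (x + t *\<^sub>R axis i 1)) has_vector_derivative
        f x * ((2 * pi * \<i> * of_int ((- k) $ i)) * character (- k) x) + D x * character (- k) x) (at 0)" for x
      using has_vector_derivative_mult[OF der[of x] character_axis_derivative[of "- k" x i]] by simp
  qed (use cont in \<open>auto intro!: continuous_intros contf simp: D_def\<close>)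
  also have "integral torus (\<lambda>x. f x * ((2 * pi * \<i> * of_int ((- k) $ i)) * character (- k) x)
      + D x * character (- k) x) =
    integral torus (\<lambda>x. (2 * pi * \<i> * of_int ((- k) $ i)) * (f x * character (- k) x)) +
    integral torus (\<lambda>x. D x * character (- k) x)"
    by (subst integral_add[symmetric])
       (use cont in \<open>auto intro!: integrable_on_torus continuous_intros contf simp: D_def mult_ac\<close>)
  finally show ?thesis
    by (simp add: fourier_coeff_def D_def integral_mult_right)
qed

lemma torus_periodic_frechet_derivative:
  assumes per: "torus_periodic f" and diff: "f differentiable_on UNIV"
  shows "torus_periodic (\<lambda>x. frechet_derivative f (at x) v)"
proof -
  have "frechet_derivative f (at (x + axis i 1)) = frechet_derivative f (at x)" for x i
  proof -
    have "(f has_derivative frechet_derivative f (at (x + axis i 1))) (at (x + axis i 1))"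
      using diff by (simp add: differentiable_on_def frechet_derivative_works)
    moreover have "((\<lambda>y. y + axis i 1) has_derivative (\<lambda>y. y)) (at x)"
      by (auto intro!: derivative_eq_intros)
    ultimately have "((\<lambda>y. f (y + axis i 1)) has_derivative
        (\<lambda>y. frechet_derivative f (at (x + axis i 1)) y)) (at x)"
      using has_derivative_compose by blast
    then have "(f has_derivative frechet_derivative f (at (x + axis i 1))) (at x)"
      using per by (simp add: torus_periodic_def)
    then show ?thesis by (rule frechet_derivative_at)
  qed
  then show ?thesis by (simp add: torus_periodic_def)
qed

lemma bounded_on_torus:
  fixes f :: "real^'d \<Rightarrow> 'b::real_normed_vector"
  assumes "continuous_on UNIV f"
  obtains B where "B \<ge> 0" "\<And>x. x \<in> torus \<Longrightarrow> norm (f x) \<le> B"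
proof -
  have "bounded (f ` torus)"
    unfolding torus_eq_cbox
    by (intro compact_imp_bounded compact_continuous_image continuous_on_subset[OF assms]) auto
  then obtain B where "\<And>x. x \<in> torus \<Longrightarrow> norm (f x) \<le> B"
    unfolding bounded_iff by blast
  then show thesis using that[of "max B 0"] by fastforce
qed

lemma fourier_coeff_decay_axis:
  fixes f :: "real^'d \<Rightarrow> complex"
  assumes "torus_periodic f" "cont_diff n f"
  shows "\<exists>C. \<forall>k. \<bar>of_int (k $ i)\<bar> ^ n * norm (fourier_coeff f k) \<le> C"
  using assms
proof (induction n arbitrary: f)
  case 0
  then have c: "continuous_on UNIV f" by simp
  obtain B where "\<And>x. x \<in> torus \<Longrightarrow> norm (f x) \<le> B" using bounded_on_torus[OF c] by blast
  then have "norm (fourier_coeff f k) \<le> B" for k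
    unfolding fourier_coeff_def
    by (intro norm_integral_torus_le continuous_intros c) (simp add: norm_mult)
  then show ?case by auto
next
  case (Suc n)
  define D where "D x = frechet_derivative f (at x) (axis i 1)" for x
  have "cont_diff n D" using Suc.prems by (simp add: D_def[abs_def])
  moreover have "torus_periodic D"
    unfolding D_def[abs_def] using Suc.prems by (intro torus_periodic_frechet_derivative) auto
  ultimately obtain C where C: "\<And>k. \<bar>of_int (k $ i)\<bar> ^ n * norm (fourier_coeff D k) \<le> C"
    using Suc.IH by blast
  have "\<bar>of_int (k $ i)\<bar> ^ Suc n * norm (fourier_coeff f k) \<le> C" for k
  proof -
    have "norm (fourier_coeff D k) = 2 * pi * (\<bar>of_int (k $ i)\<bar> * norm (fourier_coeff f k))"
      using fourier_coeff_derivative[of f i k] Suc.prems cont_diff_continuous[OF \<open>cont_diff n D\<close>]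
      by (simp add: D_def[abs_def] norm_mult)
    moreover have "1 * (\<bar>of_int (k $ i)\<bar> * norm (fourier_coeff f k))
        \<le> 2 * pi * (\<bar>of_int (k $ i)\<bar> * norm (fourier_coeff f k))"
      using pi_gt3 by (intro mult_right_mono) auto
    ultimately have "\<bar>of_int (k $ i)\<bar> * norm (fourier_coeff f k) \<le> norm (fourier_coeff D k)" by simp
    then have "\<bar>of_int (k $ i)\<bar> ^ n * (\<bar>of_int (k $ i)\<bar> * norm (fourier_coeff f k))
        \<le> \<bar>of_int (k $ i)\<bar> ^ n * norm (fourier_coeff D k)"
      by (intro mult_left_mono) auto
    then show ?thesis using C[of k] by (simp add: mult_ac)
  qed
  then show ?case by blast
qed

definition norm1 :: "int^'d \<Rightarrow> real" where
  "norm1 k = (\<Sum>i\<in>UNIV. \<bar>of_int (k $ i)\<bar>)"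

lemma norm1_nonneg: "norm1 k \<ge> 0"
  by (simp add: norm1_def sum_nonneg)

text \<open>
  Differentiating in the coordinate where \<open>k\<close> is largest in absolute value gives the decay, since
  \<open>norm1 k\<close> is at most the dimension times that largest entry.
\<close>
lemma fourier_coeff_decay:
  fixes f :: "real^'d \<Rightarrow> complex"
  assumes per: "torus_periodic f" and cd: "cont_diff n f"
  obtains C where "C \<ge> 0" "\<And>k. (1 + norm1 k) ^ n * norm (fourier_coeff f k) \<le> C"
proof -
  have "\<forall>i. \<exists>C. \<forall>k. \<bar>of_int (k $ i)\<bar> ^ n * norm (fourier_coeff f k) \<le> C"
    using fourier_coeff_decay_axis[OF per cd] by blast
  then obtain C where C: "\<And>i k. \<bar>of_int (k $ i)\<bar> ^ n * norm (fourier_coeff f k) \<le> C i"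
    by metis
  obtain C0 where C0: "\<And>k. norm (fourier_coeff f k) \<le> C0"
    using fourier_coeff_decay_axis[OF per, of 0] cont_diff_continuous[OF cd] by auto
  define c where "c = Max (insert C0 (range C))"
  define d where "d = 1 + real CARD('d)"
  have c: "C0 \<le> c" "\<And>i. C i \<le> c" unfolding c_def by (rule Max_ge; simp)+
  have "c \<ge> 0" using C0[of 0] c(1) norm_ge_zero[of "fourier_coeff f 0"] by linarith
  have "(1 + norm1 k) ^ n * norm (fourier_coeff f k) \<le> d ^ n * c" for k
  proof -
    define M where "M = Max (insert 1 (range (\<lambda>i. \<bar>of_int (k $ i)\<bar> :: real)))"
    have M: "1 \<le> M" "\<And>i. \<bar>of_int (k $ i)\<bar> \<le> M" unfolding M_def by (rule Max_ge; simp)+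
    have "M \<in> insert 1 (range (\<lambda>i. \<bar>of_int (k $ i)\<bar> :: real))"
      unfolding M_def by (rule Max_in) auto
    then have "M ^ n * norm (fourier_coeff f k) \<le> c"
    proof
      assume "M = 1"
      then show ?thesis using C0[of k] c(1) by simp
    next
      assume "M \<in> range (\<lambda>i. \<bar>of_int (k $ i)\<bar> :: real)"
      then obtain i where "M = \<bar>of_int (k $ i)\<bar>" by blast
      then show ?thesis using C[of k i] c(2)[of i] by simp
    qed
    moreover have "1 + norm1 k \<le> d * M"
    proof -
      have "norm1 k \<le> (\<Sum>i\<in>(UNIV::'d set). M)"
        unfolding norm1_def by (intro sum_mono M(2))
      then show ?thesis using M(1) by (simp add: d_def algebra_simps)
    qed
    then have "(1 + norm1 k) ^ n \<le> (d * M) ^ n"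
      using norm1_nonneg[of k] by (intro power_mono) auto
    then have "(1 + norm1 k) ^ n * norm (fourier_coeff f k) \<le> (d * M) ^ n * norm (fourier_coeff f k)"
      by (intro mult_right_mono) auto
    moreover have "d ^ n * (M ^ n * norm (fourier_coeff f k)) \<le> d ^ n * c"
      using calculation(1) by (intro mult_left_mono) (auto simp: d_def)
    ultimately show ?thesis by (simp add: power_mult_distrib mult.assoc)
  qed
  moreover have "d ^ n * c \<ge> 0" using \<open>c \<ge> 0\<close> by (simp add: d_def)
  ultimately show thesis using that by blast
qed

section \<open>Uniqueness of Fourier coefficients and Fourier inversion\<close>

text \<open>
  The torus as a product of unit circles. Under this embedding, real polynomials in the ambient space
  become trigonometric polynomials.
\<close>
definition torus_embedding :: "real^'d \<Rightarrow> complex^'d" where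
  "torus_embedding x = (\<chi> i. cis (2 * pi * x $ i))"

lemma continuous_on_torus_embedding [continuous_intros]:
  "continuous_on S torus_embedding"
  unfolding torus_embedding_def cis_conv_exp by (intro continuous_intros)

lemma continuous_on_polynomial_torus_embedding:
  fixes p :: "complex^'d \<Rightarrow> real"
  assumes "real_polynomial_function p"
  shows "continuous_on UNIV (\<lambda>x. p (torus_embedding x))"
proof -
  have "continuous_on UNIV p"
    using continuous_real_polymonial_function[OF assms] by (simp add: continuous_on_eq_continuous_at)
  then show ?thesis
    by (rule continuous_on_compose2[OF _ continuous_on_torus_embedding subset_UNIV])
qed

text \<open>
  If all Fourier coefficients of \<open>h\<close> vanish, then those of its product with any trigonometric
  polynomial vanish too: a coordinate function is a combination of two characters, and multiplication by
  a character only shifts the coefficients. The induction quantifies over \<open>h\<close>, so that the two factors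
  of a product of polynomials can be treated one after the other.
\<close>
lemma fourier_coeff_mult_polynomial_eq_0:
  fixes p :: "complex^'d \<Rightarrow> real"
  assumes "real_polynomial_function p" "continuous_on UNIV h" "\<And>k. fourier_coeff h k = 0"
  shows "fourier_coeff (\<lambda>x. h x * of_real (p (torus_embedding x))) k = 0"
  using assms
proof (induction arbitrary: h k)
  case (linear p)
  have coord: "of_real (torus_embedding x \<bullet> axis i u)
      = cnj u / 2 * character (axis i 1) x + u / 2 * character (axis i (- 1)) x" for x i u
  proof -
    have ch: "character (axis i n) x = cis (2 * pi * (of_int n * x $ i))" for n
    proof -
      have "(\<Sum>j\<in>UNIV. of_int (axis i n $ j) * x $ j) = (\<Sum>j\<in>UNIV. if j = i then of_int n * x $ j else 0)"
        by (intro sum.cong) (auto simp: axis_def)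
      then show ?thesis by (simp add: character_def)
    qed
    show ?thesis
      unfolding ch
      by (simp add: torus_embedding_def inner_axis complex_eq_iff inner_complex_def algebra_simps diff_divide_distrib)
  qed
  have p: "p z = (\<Sum>b\<in>Basis. (z \<bullet> b) * p b)" for z
  proof -
    have "p (\<Sum>b\<in>Basis. (z \<bullet> b) *\<^sub>R b) = (\<Sum>b\<in>Basis. (z \<bullet> b) * p b)"
      using bounded_linear.linear[OF linear(1)] by (simp add: linear_sum linear_scale)
    then show ?thesis by (simp add: euclidean_representation)
  qed
  have "fourier_coeff (\<lambda>x. h x * of_real (torus_embedding x \<bullet> b)) k = 0" if "b \<in> Basis" for b
  proof -
    obtain i u where b: "b = axis i u" using \<open>b \<in> Basis\<close> unfolding Basis_vec_def by blast
    have "fourier_coeff (\<lambda>x. h x * of_real (torus_embedding x \<bullet> b)) k =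
      fourier_coeff (\<lambda>x. cnj u / 2 * (h x * character (axis i 1) x)
          + u / 2 * (h x * character (axis i (- 1)) x)) k"
      unfolding b coord by (simp add: algebra_simps)
    also have "\<dots> = 0"
      by (subst fourier_coeff_add)
         (auto intro!: continuous_intros linear(2) simp only: fourier_coeff_cmult
            fourier_coeff_mult_character linear(3) mult_zero_right add_0_right)
    finally show ?thesis .
  qed
  moreover have "fourier_coeff (\<lambda>x. h x * of_real (p (torus_embedding x))) k
      = (\<Sum>b\<in>Basis. of_real (p b) * fourier_coeff (\<lambda>x. h x * of_real (torus_embedding x \<bullet> b)) k)"
    unfolding fourier_coeff_cmult[symmetric]
    by (subst fourier_coeff_sum[symmetric])
       (auto intro!: continuous_intros linear(2) simp: p[of "torus_embedding _"] sum_distrib_left mult_ac)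
  ultimately show ?case by simp
next
  case (const c)
  then show ?case
    using fourier_coeff_cmult[of "of_real c" h k] by (simp add: mult.commute)
next
  case (add p q)
  from add.hyps[THEN continuous_on_polynomial_torus_embedding]
  show ?case
    unfolding of_real_add distrib_left
    by (subst fourier_coeff_add) (auto intro!: continuous_intros simp: add)
next
  case (mult p q)
  from mult.hyps(1)[THEN continuous_on_polynomial_torus_embedding]
  have "fourier_coeff (\<lambda>x. (h x * of_real (p (torus_embedding x))) * of_real (q (torus_embedding x))) k = 0"
    using mult by (intro mult.IH(2)) (auto intro!: continuous_intros)
  then show ?case by (simp add: mult.assoc)
qed

lemma torus_embedding_eq_imp:
  assumes "torus_periodic f" "torus_embedding x = torus_embedding y"
  shows "f x = f y"
proof -
  have "(x - y) $ i \<in> \<int>" for i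
  proof -
    have "cis (2 * pi * x $ i) = cis (2 * pi * y $ i)"
      using assms(2) by (simp add: torus_embedding_def vec_eq_iff)
    then have "cis (2 * pi * x $ i - 2 * pi * y $ i) = 1"
      by (simp flip: cis_divide)
    then obtain n :: int where "2 * pi * x $ i - 2 * pi * y $ i = 2 * pi * of_int n"
      by (auto simp: complex_eq_iff cos_one_2pi_int mult_ac)
    then have "2 * pi * (x $ i - y $ i) = 2 * pi * of_int n" by (simp add: algebra_simps)
    then have "x $ i - y $ i = of_int n" by simp
    then show ?thesis by simp
  qed
  from torus_periodic_lattice[OF assms(1) this, of y] show ?thesis by simp
qed

text \<open>
  By periodicity \<open>cnj \<circ> h\<close> descends to a continuous function on the embedded torus, and polynomials
  approximate it uniformly by Stone--Weierstrass. Since \<open>h\<close> is orthogonal to all of them, it is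
  orthogonal to itself.
\<close>
lemma torus_fourier_uniqueness:
  fixes h :: "real^'d \<Rightarrow> complex"
  assumes per: "torus_periodic h" and cont: "continuous_on UNIV h"
    and zero: "\<And>k. fourier_coeff h k = 0" and x: "x \<in> torus"
  shows "h x = 0"
proof -
  define E :: "real^'d \<Rightarrow> complex^'d" where "E = torus_embedding"
  define g where "g z = cnj (h (inv_into torus E z))" for z
  have E_in: "E y \<in> E ` torus" if "y \<in> torus" for y using that by blast
  have gE: "g (E y) = cnj (h y)" if "y \<in> torus" for y
    unfolding g_def using f_inv_into_f[OF E_in[OF that]]
    by (intro arg_cong[of _ _ cnj] torus_embedding_eq_imp[OF per]) (simp add: E_def)
  have contE: "continuous_on S E" for S unfolding E_def by (rule continuous_intros)
  have compact: "compact (torus :: (real^'d) set)" by (simp add: torus_eq_cbox)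
  have contg: "continuous_on (E ` torus) g"
    unfolding continuous_on_open_gen[OF subset_UNIV[THEN image_subset_iff_funcset[THEN iffD1]]]
  proof (safe)
    fix U :: "complex set" assume U: "openin (top_of_set UNIV) U"
    have "torus \<inter> E -` (E ` torus \<inter> g -` U) = torus \<inter> (\<lambda>y. cnj (h y)) -` U"
    proof (rule set_eqI)
      show "y \<in> torus \<inter> E -` (E ` torus \<inter> g -` U) \<longleftrightarrow> y \<in> torus \<inter> (\<lambda>y. cnj (h y)) -` U" for y
        using gE[of y] E_in[of y] by (cases "y \<in> torus") simp_all
    qed
    moreover have "openin (top_of_set torus) (torus \<inter> (\<lambda>y. cnj (h y)) -` U)"
      using U by (intro continuous_openin_preimage_gen continuous_intros continuous_on_subset[OF cont]) auto
    ultimately show "openin (top_of_set (E ` torus)) (E ` torus \<inter> g -` U)"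
      using Abstract_Topology_2.continuous_imp_quotient_map[OF contE refl compact, of "E ` torus \<inter> g -` U"] by simp
  qed
  obtain B where B: "B \<ge> 0" "\<And>y. y \<in> torus \<Longrightarrow> norm (h y) \<le> B"
    using bounded_on_torus[OF cont] by blast
  have small: "norm (integral torus (\<lambda>y. h y * cnj (h y))) \<le> B * \<epsilon>" if "\<epsilon> > 0" for \<epsilon>
  proof -
    obtain P where P: "polynomial_function P" "\<And>z. z \<in> E ` torus \<Longrightarrow> norm (g z - P z) < \<epsilon>"
      using Stone_Weierstrass_polynomial_function[OF compact_continuous_image[OF contE compact] contg \<open>\<epsilon> > 0\<close>]
      by blast
    have contP: "continuous_on UNIV (\<lambda>y. P (E y))"
      using continuous_polymonial_function[OF P(1)]
      by (intro continuous_on_compose2[OF _ contE subset_UNIV]) (simp add: continuous_on_eq_continuous_at)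
    have Re: "real_polynomial_function (\<lambda>z. Re (P z))" and Im: "real_polynomial_function (\<lambda>z. Im (P z))"
      using P(1) bounded_linear_Re bounded_linear_Im unfolding polynomial_function_def o_def by blast+
    have "h y * P (E y) = h y * of_real (Re (P (E y))) + \<i> * (h y * of_real (Im (P (E y))))" for y
      by (subst complex_eq[of "P (E y)"]) (simp add: algebra_simps)
    then have "fourier_coeff (\<lambda>y. h y * P (E y)) 0
        = fourier_coeff (\<lambda>y. h y * of_real (Re (P (E y))) + \<i> * (h y * of_real (Im (P (E y))))) 0"
      by simp
    also have "\<dots> = fourier_coeff (\<lambda>y. h y * of_real (Re (P (E y)))) 0
        + fourier_coeff (\<lambda>y. \<i> * (h y * of_real (Im (P (E y))))) 0"
      by (intro fourier_coeff_add continuous_intros cont contP)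
    also have "\<dots> = 0"
      using fourier_coeff_mult_polynomial_eq_0[OF Re cont zero, of 0]
        fourier_coeff_mult_polynomial_eq_0[OF Im cont zero, of 0]
      by (simp add: fourier_coeff_cmult E_def)
    finally have "fourier_coeff (\<lambda>y. h y * P (E y)) 0 = 0" .
    then have "integral torus (\<lambda>y. h y * P (E y)) = 0"
      by (simp add: fourier_coeff_def)
    then have "integral torus (\<lambda>y. h y * cnj (h y)) = integral torus (\<lambda>y. h y * (cnj (h y) - P (E y)))"
      unfolding right_diff_distrib
      by (subst integral_diff) (auto intro!: integrable_on_torus continuous_intros cont contP)
    also have "norm \<dots> \<le> B * \<epsilon>"
    proof (rule norm_integral_torus_le)
      show "norm (h y * (cnj (h y) - P (E y))) \<le> B * \<epsilon>" if "y \<in> torus" for y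
        unfolding norm_mult using B P(2)[OF E_in[OF that]] gE[OF that] that
        by (intro mult_mono) auto
    qed (intro continuous_intros cont contP)
    finally show ?thesis .
  qed
  have "norm (integral torus (\<lambda>y. h y * cnj (h y))) \<le> 0"
  proof (rule field_le_epsilon)
    fix e :: real assume "e > 0"
    have "B * (e / (B + 1)) \<le> e"
      using B(1) \<open>e > 0\<close> by (simp add: field_simps)
    then show "norm (integral torus (\<lambda>y. h y * cnj (h y))) \<le> 0 + e"
      using small[of "e / (B + 1)"] B(1) \<open>e > 0\<close> by simp
  qed
  moreover have "(\<lambda>y. h y * cnj (h y)) integrable_on torus"
    by (intro integrable_on_torus continuous_intros cont)
  ultimately have "((\<lambda>y. h y * cnj (h y)) has_integral 0) torus"
    using integrable_integral by fastforce
  then have "((\<lambda>y. (norm (h y))\<^sup>2) has_integral 0) (cbox 0 1)"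
    using has_integral_Re[of _ "0::complex"] unfolding complex_norm_square[symmetric] torus_eq_cbox
    by (metis (no_types, lifting) Re_complex_of_real has_integral_cong zero_complex.simps(1))
  moreover have "continuous_on (cbox 0 1) (\<lambda>y. (norm (h y))\<^sup>2)"
    by (intro continuous_intros continuous_on_subset[OF cont subset_UNIV])
  ultimately have "(norm (h x))\<^sup>2 = 0"
    using x by (intro has_integral_0_cbox_imp_0[of 0 1 "\<lambda>y. (norm (h y))\<^sup>2"])
      (auto simp: torus_eq_cbox interval_ne_empty_cart)
  then show ?thesis by simp
qed

lemma torus_rotation: "rotation r s \<theta> \<in> torus"
  by (auto simp: torus_def rotation_def less_imp_le[OF frac_lt_1])

text \<open>
  The sum of the series is continuous and periodic and has the same Fourier coefficients as \<open>f\<close>, so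
  it equals \<open>f\<close>.
\<close>
lemma fourier_inversion:
  fixes f :: "real^'d \<Rightarrow> complex"
  assumes per: "torus_periodic f" and cont: "continuous_on UNIV f"
    and summ: "(\<lambda>k. norm (fourier_coeff f k)) summable_on UNIV"
  shows "((\<lambda>k. fourier_coeff f k * character k x) has_sum f x) UNIV"
proof -
  define c where "c = fourier_coeff f"
  define g where "g x = (\<Sum>\<^sub>\<infinity>k. c k * character k x)" for x
  have hs: "((\<lambda>k. c k * character k x) has_sum g x) UNIV" for x
    unfolding g_def
    by (rule has_sum_infsum[OF abs_summable_summable]) (use summ in \<open>simp add: norm_mult c_def\<close>)
  have unif: "uniform_limit UNIV (\<lambda>A x. \<Sum>k\<in>A. c k * character k x) g (finite_subsets_at_top UNIV)"
    by (rule Weierstrass_m_test_general'[where M = "\<lambda>k. norm (c k)", OF _ hs]) (use summ in \<open>simp_all add: norm_mult c_def\<close>)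
  have contg: "continuous_on UNIV g"
    by (rule uniform_limit_theorem[OF _ unif]) (auto intro!: always_eventually continuous_intros)
  have perg: "torus_periodic g"
  proof -
    have "character k (y + axis i 1) = character k y" for k :: "int^'d" and y i
      using torus_periodic_character[of k] by (simp add: torus_periodic_def)
    then show ?thesis by (simp add: torus_periodic_def g_def)
  qed
  have coeff: "fourier_coeff g j = c j" for j
  proof -
    have hs': "((\<lambda>k. c k * character (k - j) x) has_sum (g x * character (- j) x)) UNIV" for x
      using has_sum_cmult_left[OF hs[of x], of "character (- j) x"]
      by (simp add: mult.assoc character_add_index[symmetric])
    have unif': "uniform_limit (cbox 0 1) (\<lambda>A x. \<Sum>k\<in>A. c k * character (k - j) x)
        (\<lambda>x. g x * character (- j) x) (finite_subsets_at_top UNIV)"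
      by (rule Weierstrass_m_test_general'[where M = "\<lambda>k. norm (c k)", OF _ hs'])
         (use summ in \<open>simp_all add: norm_mult c_def\<close>)
    obtain I J where IJ: "\<And>A. ((\<lambda>x. \<Sum>k\<in>A. c k * character (k - j) x) has_integral I A) (cbox 0 1)"
      "((\<lambda>x. g x * character (- j) x) has_integral J) (cbox 0 1)"
      "(I \<longlongrightarrow> J) (finite_subsets_at_top UNIV)"
    proof (rule uniform_limit_integral_cbox[OF unif'])
      show "continuous_on (cbox 0 1) (\<lambda>x. \<Sum>k\<in>A. c k * character (k - j) x)" for A
        by (intro continuous_intros)
    qed (simp, blast)
    have "I A = c j" if "finite A" "j \<in> A" for A
    proof -
      have "I A = integral torus (\<lambda>x. \<Sum>k\<in>A. c k * character (k - j) x)"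
        using IJ(1)[of A] by (simp add: torus_eq_cbox integral_unique)
      also have "\<dots> = (\<Sum>k\<in>A. integral torus (\<lambda>x. c k * character (k - j) x))"
        using that(1) by (intro integral_sum integrable_on_torus continuous_intros)
      also have "\<dots> = (\<Sum>k\<in>A. if k = j then c k else 0)"
        by (intro sum.cong) (auto simp: integral_mult_right integral_character)
      also have "\<dots> = c j" using that by simp
      finally show ?thesis .
    qed
    then have "eventually (\<lambda>A. I A = c j) (finite_subsets_at_top UNIV)"
      unfolding eventually_finite_subsets_at_top by (intro exI[of _ "{j}"]) auto
    then have "(I \<longlongrightarrow> c j) (finite_subsets_at_top UNIV)"
      by (rule tendsto_eventually)
    then have "J = c j"
      using IJ(3) by (intro tendsto_unique[of "finite_subsets_at_top UNIV" I]) auto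
    then show ?thesis
      using IJ(2) by (simp add: fourier_coeff_def torus_eq_cbox integral_unique)
  qed
  have "f y - g y = 0" if "y \<in> torus" for y
  proof (rule torus_fourier_uniqueness[of "\<lambda>y. f y - g y"])
    show "torus_periodic (\<lambda>y. f y - g y)" using per perg by (simp add: torus_periodic_def)
    show "fourier_coeff (\<lambda>y. f y - g y) k = 0" for k
      using fourier_coeff_diff[OF cont contg, of k] coeff[of k] by (simp add: c_def)
  qed (use that in \<open>auto intro!: continuous_intros cont contg\<close>)
  \<comment> \<open>The rotation by \<open>0\<close> reduces an arbitrary point modulo \<open>1\<close> to the torus.\<close>
  from this[OF torus_rotation[of 0 0 x]] have "f x = g x"
    using torus_periodic_rotation[OF per, of 0 0 x] torus_periodic_rotation[OF perg, of 0 0 x] by simp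
  then show ?thesis using hs[of x] by (simp add: c_def)
qed

section \<open>Weighted summability of Fourier coefficients\<close>

text \<open>
  Every finite set of functions lies in a finite box, and over a box the sum of products is the product
  of sums.
\<close>
lemma summable_on_prod_fun:
  fixes f :: "'i::finite \<Rightarrow> 'a \<Rightarrow> real"
  assumes nonneg: "\<And>i a. 0 \<le> f i a" and summ: "\<And>i. f i summable_on UNIV"
  shows "(\<lambda>g. \<Prod>i\<in>UNIV. f i (g i)) summable_on UNIV"
proof (rule nonneg_bounded_partial_sums_imp_summable_on)
  show "\<forall>\<^sub>F X in finite_subsets_at_top UNIV. (\<Sum>g\<in>X. \<Prod>i\<in>UNIV. f i (g i)) \<le> (\<Prod>i\<in>UNIV. \<Sum>\<^sub>\<infinity>a. f i a)"
  proof (rule eventually_finite_subsets_at_top_weakI)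
    fix X :: "('i \<Rightarrow> 'a) set" assume X: "finite X"
    define Y where "Y i = (\<lambda>g. g i) ` X" for i
    have Y: "finite (Y i)" for i using X by (simp add: Y_def)
    have "(\<Sum>g\<in>X. \<Prod>i\<in>UNIV. f i (g i)) \<le> (\<Sum>g\<in>PiE UNIV Y. \<Prod>i\<in>UNIV. f i (g i))"
      by (rule sum_mono2) (auto simp: Y_def intro!: finite_PiE Y[unfolded Y_def] prod_nonneg nonneg)
    also have "\<dots> = (\<Prod>i\<in>UNIV. \<Sum>a\<in>Y i. f i a)"
      by (rule prod_sum_PiE[symmetric]) (auto simp: Y)
    also have "\<dots> \<le> (\<Prod>i\<in>UNIV. \<Sum>\<^sub>\<infinity>a. f i a)"
      by (intro prod_mono conjI sum_nonneg nonneg finite_sum_le_infsum summ Y) auto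
    finally show "(\<Sum>g\<in>X. \<Prod>i\<in>UNIV. f i (g i)) \<le> (\<Prod>i\<in>UNIV. \<Sum>\<^sub>\<infinity>a. f i a)" .
  qed
qed (intro prod_nonneg nonneg)

lemma summable_on_int_powr:
  assumes "p > 1"
  shows "(\<lambda>n::int. (1 + \<bar>of_int n\<bar>) powr (- p) :: real) summable_on UNIV"
proof -
  have "summable (\<lambda>n. real (Suc n) powr (- p))"
    using assms summable_real_powr_iff[of "- p"] by (subst summable_Suc_iff) simp
  then have nat: "(\<lambda>n. real (Suc n) powr (- p)) summable_on UNIV"
    by (rule summable_nonneg_imp_summable_on) simp
  have "(\<lambda>n. (1 + \<bar>of_int n\<bar>) powr (- p) :: real) summable_on range int"
    using nat by (subst summable_on_reindex) (auto simp: o_def algebra_simps)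
  moreover have "(\<lambda>n. (1 + \<bar>of_int n\<bar>) powr (- p) :: real) summable_on range (\<lambda>n. - int n)"
    using nat by (subst summable_on_reindex) (auto simp: o_def algebra_simps inj_on_def)
  ultimately have "(\<lambda>n. (1 + \<bar>of_int n\<bar>) powr (- p) :: real) summable_on (range int \<union> range (\<lambda>n. - int n))"
    by (rule summable_on_union)
  moreover have "range int \<union> range (\<lambda>n. - int n) = UNIV"
    by (auto intro: int_cases2)
  ultimately show ?thesis by simp
qed

text \<open>
  Since \<open>1 + norm1 k\<close> dominates each \<open>1 + \<bar>k $ i\<bar>\<close>, its power \<open>- s\<close> is at most the product over
  \<open>i\<close> (in dimension \<open>d\<close>) of the powers \<open>- s / d\<close> of these factors. The exponent \<open>s / d\<close> exceeds \<open>1\<close>, so each factor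
  is summable over the integers.
\<close>
lemma summable_on_norm1_powr:
  assumes "s > real CARD('d)"
  shows "(\<lambda>k::int^'d. (1 + norm1 k) powr (- s)) summable_on UNIV"
proof -
  define p where "p = s / real CARD('d)"
  have p: "p > 1" using assms by (simp add: p_def)
  have "(\<lambda>g::'d \<Rightarrow> int. \<Prod>i\<in>UNIV. (1 + \<bar>of_int (g i)\<bar>) powr (- p) :: real) summable_on UNIV"
    by (rule summable_on_prod_fun) (auto intro!: summable_on_int_powr p)
  moreover have "bij_betw (\<lambda>k::int^'d. vec_nth k) UNIV UNIV"
    by (rule bij_betw_byWitness[of _ vec_lambda]) auto
  ultimately have "(\<lambda>k::int^'d. \<Prod>i\<in>UNIV. (1 + \<bar>of_int (k $ i)\<bar>) powr (- p) :: real) summable_on UNIV"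
    using summable_on_reindex_bij_betw by fast
  then show ?thesis
  proof (rule summable_on_comparison_test)
    fix k :: "int^'d"
    have pos: "0 < 1 + norm1 k" using norm1_nonneg[of k] by linarith
    have "(1 + norm1 k) powr (- s) = (\<Prod>i\<in>(UNIV::'d set). (1 + norm1 k) powr (- p))"
      using pos by (simp add: p_def powr_powr powr_realpow[symmetric])
    also have "\<dots> \<le> (\<Prod>i\<in>UNIV. (1 + \<bar>of_int (k $ i)\<bar>) powr (- p))"
    proof (intro prod_mono conjI)
      fix i :: 'd
      have "\<bar>real_of_int (k $ i)\<bar> \<le> norm1 k"
        unfolding norm1_def by (rule member_le_sum) auto
      then show "(1 + norm1 k) powr (- p) \<le> (1 + \<bar>of_int (k $ i)\<bar>) powr (- p)"
        using p by (intro powr_mono2') auto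
    qed simp
    finally show "(1 + norm1 k) powr (- s) \<le> (\<Prod>i\<in>UNIV. (1 + \<bar>of_int (k $ i)\<bar>) powr (- p))" .
  qed simp
qed

lemma summable_on_weighted_fourier_coeff:
  fixes f :: "real^'d \<Rightarrow> complex"
  assumes "torus_periodic f" "cont_diff n f" and s: "real n > real CARD('d) + s"
  shows "(\<lambda>k. (1 + norm1 k) powr s * norm (fourier_coeff f k)) summable_on UNIV"
proof -
  obtain C where C: "C \<ge> 0" "\<And>k. (1 + norm1 k) ^ n * norm (fourier_coeff f k) \<le> C"
    using fourier_coeff_decay[OF assms(1,2)] by blast
  have "(\<lambda>k::int^'d. C * (1 + norm1 k) powr (- (real n - s))) summable_on UNIV"
    using s by (intro summable_on_cmult_right summable_on_norm1_powr) simp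
  then show ?thesis
  proof (rule summable_on_comparison_test)
    fix k :: "int^'d"
    have pos: "0 < 1 + norm1 k" using norm1_nonneg[of k] by linarith
    have "(1 + norm1 k) powr s * norm (fourier_coeff f k)
        = (1 + norm1 k) powr (- (real n - s)) * ((1 + norm1 k) ^ n * norm (fourier_coeff f k))"
      using pos by (simp add: powr_realpow[symmetric] powr_add[symmetric] mult.assoc[symmetric])
    also have "\<dots> \<le> (1 + norm1 k) powr (- (real n - s)) * C"
      by (intro mult_left_mono C(2)) simp
    finally show "(1 + norm1 k) powr s * norm (fourier_coeff f k) \<le> C * (1 + norm1 k) powr (- (real n - s))"
      by (simp add: mult.commute)
  qed simp
qed

lemma has_sum_prod_fun:
  fixes f :: "'i::finite \<Rightarrow> 'a \<Rightarrow> complex"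
  assumes "\<And>i. (\<lambda>a. norm (f i a)) summable_on UNIV" "\<And>i. (f i has_sum S i) UNIV"
  shows "((\<lambda>g. \<Prod>i\<in>UNIV. f i (g i)) has_sum (\<Prod>i\<in>UNIV. S i)) UNIV"
proof -
  have "(\<lambda>g. \<Prod>i\<in>UNIV. norm (f i (g i))) summable_on UNIV"
    by (rule summable_on_prod_fun) (auto intro: assms)
  then have "(\<lambda>g. \<Prod>i\<in>UNIV. f i (g i)) summable_on UNIV"
    by (rule abs_summable_summable[OF summable_on_cong[THEN iffD1, rotated]]) (simp add: prod_norm)
  moreover have "(\<Sum>\<^sub>\<infinity>g. \<Prod>i\<in>UNIV. f i (g i)) = (\<Prod>i\<in>UNIV. S i)"
    using infsum_prod_PiE_abs[of "UNIV :: 'i set" f "\<lambda>_. UNIV"] assms(1)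
    by (simp add: infsumI[OF assms(2)] PiE_UNIV_domain)
  ultimately show ?thesis using has_sum_iff by blast
qed

section \<open>Averaging functionals on quasiperiodic signals\<close>

text \<open>
  The common features of the discrete and the continuous weighted average: linearity, norm \<open>1\<close> and
  preservation of constants, all on continuous signals only.
\<close>
definition averaging_functional :: "((real \<Rightarrow> complex) \<Rightarrow> complex) \<Rightarrow> bool" where
  "averaging_functional L \<longleftrightarrow>
     (\<forall>f g. continuous_on UNIV f \<longrightarrow> continuous_on UNIV g \<longrightarrow> L (\<lambda>s. f s + g s) = L f + L g) \<and>
     (\<forall>f c. continuous_on UNIV f \<longrightarrow> L (\<lambda>s. c * f s) = c * L f) \<and>
     (\<forall>f B. continuous_on UNIV f \<longrightarrow> (\<forall>s. norm (f s) \<le> B) \<longrightarrow> norm (L f) \<le> B) \<and>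
     L (\<lambda>s. 1) = 1"

lemma
  assumes "averaging_functional L"
  shows averaging_functional_add:
      "continuous_on UNIV f \<Longrightarrow> continuous_on UNIV g \<Longrightarrow> L (\<lambda>s. f s + g s) = L f + L g"
    and averaging_functional_cmult: "continuous_on UNIV f \<Longrightarrow> L (\<lambda>s. c * f s) = c * L f"
    and averaging_functional_bound:
      "continuous_on UNIV f \<Longrightarrow> (\<And>s. norm (f s) \<le> B) \<Longrightarrow> norm (L f) \<le> B"
    and averaging_functional_one: "L (\<lambda>s. 1) = 1"
  using assms unfolding averaging_functional_def by blast+

lemma averaging_functional_sum:
  assumes L: "averaging_functional L" and "finite A" "\<And>k. continuous_on UNIV (e k)"
  shows "L (\<lambda>s. \<Sum>k\<in>A. a k * e k s) = (\<Sum>k\<in>A. a k * L (e k))"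
  using assms(2)
proof induction
  case empty
  have "L (\<lambda>s. 0 * 1) = 0 * L (\<lambda>s. 1)"
    by (rule averaging_functional_cmult[OF L]) (rule continuous_on_const)
  then show ?case by simp
next
  case (insert k A)
  have "L (\<lambda>s. a k * e k s + (\<Sum>k\<in>A. a k * e k s)) = L (\<lambda>s. a k * e k s) + L (\<lambda>s. \<Sum>k\<in>A. a k * e k s)"
    by (intro averaging_functional_add[OF L] continuous_intros assms(3))
  moreover have "L (\<lambda>s. a k * e k s) = a k * L (e k)"
    by (rule averaging_functional_cmult[OF L assms(3)])
  ultimately show ?case using insert by simp
qed

lemma continuous_on_cis_linear: "continuous_on S (\<lambda>s. cis (2 * pi * (b * s)))"
  unfolding cis_conv_exp by (intro continuous_intros)

text \<open>
  The series converges uniformly and the functional has norm \<open>1\<close>, so a finite partial sum replaces the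
  series up to an arbitrarily small error. No separate exchange of a limit with a sum or an integral is
  needed for the two averages.
\<close>
lemma averaging_functional_exponential_series:
  fixes a :: "'k \<Rightarrow> complex"
  assumes L: "averaging_functional L"
    and hs: "\<And>s. ((\<lambda>k. a k * cis (2 * pi * (\<beta> k * s))) has_sum G s) UNIV"
    and b: "\<And>k. 1 \<le> b k" and summ: "(\<lambda>k. b k * norm (a k)) summable_on UNIV"
    and k0: "\<beta> k0 = 0" and \<epsilon>: "\<epsilon> \<ge> 0"
    and small: "\<And>k. k \<noteq> k0 \<Longrightarrow> norm (L (\<lambda>s. cis (2 * pi * (\<beta> k * s)))) \<le> \<epsilon> * b k"
  shows "norm (L G - a k0) \<le> \<epsilon> * (\<Sum>\<^sub>\<infinity>k. b k * norm (a k))"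
proof (rule field_le_epsilon)
  fix d :: real assume d: "d > 0"
  define e where "e k s = cis (2 * pi * (\<beta> k * s))" for k s
  have conte: "continuous_on S (e k)" for S k
    unfolding e_def by (rule continuous_on_cis_linear)
  have "(\<lambda>k. norm (a k)) summable_on UNIV"
  proof (rule summable_on_comparison_test[OF summ])
    show "norm (a k) \<le> b k * norm (a k)" for k
      using mult_right_mono[OF b norm_ge_zero] by simp
  qed simp
  then have unif: "uniform_limit UNIV (\<lambda>A s. \<Sum>k\<in>A. a k * e k s) G (finite_subsets_at_top UNIV)"
    using hs by (intro Weierstrass_m_test_general'[where M = "\<lambda>k. norm (a k)"])
      (auto simp: norm_mult e_def)
  have contG: "continuous_on UNIV G"
    by (rule uniform_limit_theorem[OF _ unif]) (auto intro!: always_eventually continuous_intros conte)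
  obtain A0 where A0: "finite A0"
    "\<And>A s. finite A \<Longrightarrow> A0 \<subseteq> A \<Longrightarrow> dist (\<Sum>k\<in>A. a k * e k s) (G s) < d"
    using uniform_limitD[OF unif d] unfolding eventually_finite_subsets_at_top by auto
  define A where "A = insert k0 A0"
  define S where "S s = (\<Sum>k\<in>A. a k * e k s)" for s
  have A: "finite A" "k0 \<in> A" using A0(1) by (auto simp: A_def)
  have contS: "continuous_on UNIV S" unfolding S_def by (intro continuous_intros conte)
  have GS: "L G = L S + L (\<lambda>s. G s + - 1 * S s)"
  proof -
    have "L (\<lambda>s. S s + (G s + - 1 * S s)) = L S + L (\<lambda>s. G s + - 1 * S s)"
      by (intro averaging_functional_add[OF L] continuous_intros contG contS)
    moreover have "(\<lambda>s. S s + (G s + - 1 * S s)) = G" by auto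
    ultimately show ?thesis by simp
  qed
  have tail: "norm (L (\<lambda>s. G s + - 1 * S s)) \<le> d"
  proof (rule averaging_functional_bound[OF L])
    show "norm (G s + - 1 * S s) \<le> d" for s
      using A0(2)[OF A(1), of s] by (simp add: A_def S_def dist_norm norm_minus_commute subset_insertI)
  qed (intro continuous_intros contG contS)
  have "L S = (\<Sum>k\<in>A. a k * L (e k))"
    unfolding S_def by (rule averaging_functional_sum[OF L A(1) conte])
  also have "\<dots> = a k0 * L (e k0) + (\<Sum>k\<in>A - {k0}. a k * L (e k))"
    using A by (rule sum.remove)
  also have "L (e k0) = 1"
    using averaging_functional_one[OF L] by (simp add: e_def[abs_def] k0)
  finally have "norm (L S - a k0) = norm (\<Sum>k\<in>A - {k0}. a k * L (e k))" by simp
  also have "\<dots> \<le> (\<Sum>k\<in>A - {k0}. \<epsilon> * (b k * norm (a k)))"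
  proof (rule sum_norm_le)
    fix k assume "k \<in> A - {k0}"
    then have "norm (L (e k)) \<le> \<epsilon> * b k" using small[of k] by (simp add: e_def[abs_def])
    then have "norm (L (e k)) * norm (a k) \<le> \<epsilon> * b k * norm (a k)" by (rule mult_right_mono) simp
    then show "norm (a k * L (e k)) \<le> \<epsilon> * (b k * norm (a k))" by (simp add: norm_mult mult_ac)
  qed
  also have "\<dots> = \<epsilon> * (\<Sum>k\<in>A - {k0}. b k * norm (a k))" by (rule sum_distrib_left[symmetric])
  also have "\<dots> \<le> \<epsilon> * (\<Sum>\<^sub>\<infinity>k. b k * norm (a k))"
  proof (intro mult_left_mono finite_sum_le_infsum summ \<epsilon>)
    show "0 \<le> b k * norm (a k)" for k using b[of k] by simp
  qed (use A in auto)
  finally have "norm (L S - a k0) \<le> \<epsilon> * (\<Sum>\<^sub>\<infinity>k. b k * norm (a k))" .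
  moreover have "norm (L G - a k0) \<le> norm (L S - a k0) + norm (L (\<lambda>s. G s + - 1 * S s))"
    unfolding GS using norm_triangle_ineq[of "L S - a k0" "L (\<lambda>s. G s + - 1 * S s)"]
    by (simp add: algebra_simps)
  ultimately show "norm (L G - a k0) \<le> \<epsilon> * (\<Sum>\<^sub>\<infinity>k. b k * norm (a k)) + d"
    using tail by linarith
qed

lemma character_scaleR: "character k (s *\<^sub>R r) = cis (2 * pi * ((\<Sum>i\<in>UNIV. of_int (k $ i) * r $ i) * s))"
proof -
  have "(\<Sum>i\<in>UNIV. of_int (k $ i) * (s *\<^sub>R r) $ i) = (\<Sum>i\<in>UNIV. of_int (k $ i) * r $ i) * s"
    unfolding sum_distrib_right by (intro sum.cong) (simp_all add: mult_ac)
  then show ?thesis by (simp only: character_def)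
qed

lemma prod_cis: "(\<Prod>j\<in>A. cis (g j)) = cis (\<Sum>j\<in>A. g j)"
  by (induction A rule: infinite_finite_induct) (simp_all add: cis_mult)

text \<open>
  The bound on the nonconstant exponentials that follows from a Diophantine condition with exponent \<open>\<tau>\<close>;
  in that application \<open>s = m * \<tau>\<close>, and \<open>\<epsilon>\<close> is a constant times the \<open>- m\<close>-th power of the time span.
\<close>
definition damps_modes :: "((real \<Rightarrow> complex) \<Rightarrow> complex) \<Rightarrow> real^'d^'l \<Rightarrow> real \<Rightarrow> real \<Rightarrow> bool" where
  "damps_modes L \<rho> s \<epsilon> \<longleftrightarrow>
     (\<forall>k. k \<noteq> 0 \<longrightarrow> norm (L (\<lambda>t. cis (2 * pi * (int_dot k \<rho> * t)))) \<le> \<epsilon> * int_norm1 k powr s)"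

text \<open>
  The series of the product is indexed by tuples \<open>k\<close> of frequencies, one for each \<open>j\<close>. Its majorant
  \<open>\<Prod>j. (1 + norm1 (k j)) powr s * norm (fourier_coeff (f j) (k j))\<close> factors over \<open>j\<close>, so for
  given \<open>s\<close> the smoothness required of each \<open>f j\<close> does not grow with the number of functions. The base point \<open>\<theta>\<close>
  enters only through unimodular factors, which makes the constant independent of it.
\<close>
lemma averaging_functional_torus_product:
  fixes f :: "'l::finite \<Rightarrow> real^'d \<Rightarrow> complex"
  assumes per: "\<And>j. torus_periodic (f j)" and cd: "\<And>j. cont_diff n (f j)"
    and s: "0 \<le> s" "real n > real CARD('d) + s"
  obtains C where "C \<ge> 0"
    and "\<And>L \<epsilon> \<rho> \<theta>. averaging_functional L \<Longrightarrow> 0 \<le> \<epsilon> \<Longrightarrow>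
      damps_modes L \<rho> s \<epsilon> \<Longrightarrow>
      norm (L (\<lambda>t. \<Prod>j\<in>UNIV. f j (\<theta> + t *\<^sub>R \<rho> $ j)) - (\<Prod>j\<in>UNIV. integral torus (f j))) \<le> \<epsilon> * C"
proof -
  define b where "b k = (\<Prod>j\<in>UNIV. (1 + norm1 (k j)) powr s)" for k :: "'l \<Rightarrow> int^'d"
  define c where "c k = (\<Prod>j\<in>UNIV. fourier_coeff (f j) (k j))" for k :: "'l \<Rightarrow> int^'d"
  have n1: "1 \<le> 1 + norm1 k" for k :: "int^'d" using norm1_nonneg[of k] by simp
  have b1: "1 \<le> b k" for k
    unfolding b_def by (intro prod_ge_1 ge_one_powr_ge_zero n1 s)
  have wsum: "(\<lambda>k. (1 + norm1 k) powr s * norm (fourier_coeff (f j) k)) summable_on UNIV" for j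
    by (rule summable_on_weighted_fourier_coeff[OF per cd s(2)])
  have csum: "(\<lambda>k. norm (fourier_coeff (f j) k)) summable_on UNIV" for j
  proof (rule summable_on_comparison_test[OF wsum[of j]])
    show "norm (fourier_coeff (f j) k) \<le> (1 + norm1 k) powr s * norm (fourier_coeff (f j) k)" for k
      using mult_right_mono[OF ge_one_powr_ge_zero[OF n1[of k] s(1)] norm_ge_zero[of "fourier_coeff (f j) k"]]
      by simp
  qed simp
  have bc: "(\<lambda>k. b k * norm (c k)) summable_on UNIV"
    unfolding b_def c_def prod_norm[symmetric] prod.distrib[symmetric]
    by (rule summable_on_prod_fun) (auto intro: wsum)
  show thesis
  proof (rule that)
    show "0 \<le> (\<Sum>\<^sub>\<infinity>k. b k * norm (c k))"
      by (intro infsum_nonneg mult_nonneg_nonneg norm_ge_zero order_trans[OF zero_le_one b1])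
    fix L \<epsilon> and \<rho> :: "real^'d^'l" and \<theta> :: "real^'d"
    assume L: "averaging_functional L" and \<epsilon>: "0 \<le> \<epsilon>"
      and small: "damps_modes L \<rho> s \<epsilon>"
    define a where "a k = c k * (\<Prod>j\<in>UNIV. character (k j) \<theta>)" for k
    have norm_a: "norm (a k) = norm (c k)" for k
      by (simp add: a_def norm_mult flip: prod_norm)
    define \<beta> where "\<beta> k = int_dot (\<chi> j. k j) \<rho>" for k
    define k0 :: "'l \<Rightarrow> int^'d" where "k0 = (\<lambda>j. 0)"
    have "norm (L (\<lambda>t. \<Prod>j\<in>UNIV. f j (\<theta> + t *\<^sub>R \<rho> $ j)) - a k0) \<le> \<epsilon> * (\<Sum>\<^sub>\<infinity>k. b k * norm (a k))"
    proof (rule averaging_functional_exponential_series[OF L, where \<beta> = \<beta>])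
      fix t :: real
      have "((\<lambda>k. \<Prod>j\<in>UNIV. fourier_coeff (f j) (k j) * character (k j) (\<theta> + t *\<^sub>R \<rho> $ j)) has_sum
          (\<Prod>j\<in>UNIV. f j (\<theta> + t *\<^sub>R \<rho> $ j))) UNIV"
        by (rule has_sum_prod_fun)
           (auto simp: norm_mult intro: csum fourier_inversion[OF per cont_diff_continuous[OF cd] csum])
      moreover have "(\<Prod>j\<in>UNIV. fourier_coeff (f j) (k j) * character (k j) (\<theta> + t *\<^sub>R \<rho> $ j))
          = a k * cis (2 * pi * (\<beta> k * t))" for k
        by (simp add: a_def c_def \<beta>_def int_dot_def character_add character_scaleR prod.distrib prod_cis
            sum_distrib_left sum_distrib_right mult_ac)
      ultimately show "((\<lambda>k. a k * cis (2 * pi * (\<beta> k * t))) has_sum (\<Prod>j\<in>UNIV. f j (\<theta> + t *\<^sub>R \<rho> $ j))) UNIV"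
        by simp
    next
      show "\<beta> k0 = 0" by (simp add: \<beta>_def k0_def int_dot_def)
      fix k assume "k \<noteq> k0"
      then have "(\<chi> j. k j) \<noteq> (0 :: int^'d^'l)" by (auto simp: k0_def vec_eq_iff)
      then have "norm (L (\<lambda>t. cis (2 * pi * (\<beta> k * t)))) \<le> \<epsilon> * int_norm1 (\<chi> j. k j) powr s"
        using small unfolding \<beta>_def damps_modes_def by blast
      also have "int_norm1 (\<chi> j. k j) powr s \<le> b k"
      proof -
        have "int_norm1 (\<chi> j. k j) = (\<Sum>j\<in>UNIV. norm1 (k j))"
          by (simp add: int_norm1_def norm1_def)
        also have "\<dots> \<le> (\<Prod>j\<in>UNIV. 1 + norm1 (k j))"
          by (rule sum_le_prod) (rule norm1_nonneg)
        finally have "int_norm1 (\<chi> j. k j) powr s \<le> (\<Prod>j\<in>UNIV. 1 + norm1 (k j)) powr s"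
          by (intro powr_mono2 s(1)) (auto simp: int_norm1_def intro!: sum_nonneg)
        also have "\<dots> = b k"
          unfolding b_def by (rule prod_powr_distrib)
        finally show ?thesis .
      qed
      finally show "norm (L (\<lambda>t. cis (2 * pi * (\<beta> k * t)))) \<le> \<epsilon> * b k"
        using \<epsilon> by (simp add: mult_left_mono)
    qed (use b1 bc \<epsilon> in \<open>simp_all add: norm_a\<close>)
    moreover have "a k0 = (\<Prod>j\<in>UNIV. integral torus (f j))"
      by (simp add: a_def c_def k0_def fourier_coeff_def)
    ultimately show "norm (L (\<lambda>t. \<Prod>j\<in>UNIV. f j (\<theta> + t *\<^sub>R \<rho> $ j)) - (\<Prod>j\<in>UNIV. integral torus (f j)))
        \<le> \<epsilon> * (\<Sum>\<^sub>\<infinity>k. b k * norm (c k))"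
      by (simp add: norm_a)
  qed
qed

section \<open>The two weighted averages as averaging functionals\<close>

lemma averaging_functional_discrete:
  assumes "4 \<le> N"
  shows "averaging_functional (\<lambda>f. (1 / weight_sum N) *\<^sub>R (\<Sum>n<N. weight (real n / real N) *\<^sub>R f (real n)))"
proof -
  obtain a where "a > 0" "a * real N \<le> weight_sum N" using weight_sum_ge assms by metis
  moreover have "0 < a * real N" using \<open>a > 0\<close> assms by simp
  ultimately have pos: "weight_sum N > 0" by linarith
  have "norm ((1 / weight_sum N) *\<^sub>R (\<Sum>n<N. weight (real n / real N) *\<^sub>R f (real n))) \<le> B"
    if "\<And>s. norm (f s) \<le> B" for f :: "real \<Rightarrow> complex" and B
  proof -
    have "norm (\<Sum>n<N. weight (real n / real N) *\<^sub>R f (real n)) \<le> (\<Sum>n<N. weight (real n / real N) * B)"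
      by (intro sum_norm_le) (auto intro!: mult_left_mono that simp: weight_nonneg)
    also have "\<dots> = weight_sum N * B" by (simp add: weight_sum_def sum_distrib_right)
    finally show ?thesis using pos by (simp add: pos_divide_le_eq mult.commute)
  qed
  moreover have "(\<Sum>n<N. weight (real n / real N) *\<^sub>R (1 :: complex)) = of_real (weight_sum N)"
    by (simp add: weight_sum_def scaleR_conv_of_real)
  ultimately show ?thesis
    unfolding averaging_functional_def using pos
    by (intro conjI allI impI)
       (simp_all add: sum.distrib sum_distrib_left scaleR_conv_of_real add_divide_distrib algebra_simps)
qed

lemma continuous_on_weight [continuous_intros]:
  "continuous_on S f \<Longrightarrow> continuous_on S (\<lambda>x. weight (f x))"
proof -
  have "continuous_on UNIV weight"
    using continuous_on_mult_left[OF flat_product_continuous, of _ "inverse bump_mass"]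
    by (simp add: weight_eq_flat[abs_def])
  then show "continuous_on S f \<Longrightarrow> continuous_on S (\<lambda>x. weight (f x))"
    by (rule continuous_on_compose2) auto
qed

lemma averaging_functional_continuous:
  assumes T: "0 < T"
  shows "averaging_functional (\<lambda>f. (1 / T) *\<^sub>R integral {0..T} (\<lambda>s. weight (s / T) *\<^sub>R f s))"
proof -
  have wT: "((\<lambda>s. weight (s / T)) has_integral T) {0..T}"
    using has_integral_affinity'[of weight 1 0 1 "1 / T" 0] weight_has_integral T
    by (simp add: cbox_interval)
  have int: "(\<lambda>s. weight (s / T) *\<^sub>R f s) integrable_on {0..T}"
    if "continuous_on UNIV f" for f :: "real \<Rightarrow> complex"
    using T by (intro integrable_continuous_interval continuous_intros continuous_on_subset[OF that]) auto
  have add: "integral {0..T} (\<lambda>s. weight (s / T) *\<^sub>R (f s + g s))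
      = integral {0..T} (\<lambda>s. weight (s / T) *\<^sub>R f s) + integral {0..T} (\<lambda>s. weight (s / T) *\<^sub>R g s)"
    if "continuous_on UNIV f" "continuous_on UNIV g" for f g :: "real \<Rightarrow> complex"
    unfolding scaleR_right_distrib by (intro integral_add int that)
  have mult: "integral {0..T} (\<lambda>s. weight (s / T) *\<^sub>R (c * f s))
      = c * integral {0..T} (\<lambda>s. weight (s / T) *\<^sub>R f s)" for c and f :: "real \<Rightarrow> complex"
    unfolding mult_scaleR_right[symmetric] by (rule integral_mult_right)
  have bound: "norm ((1 / T) *\<^sub>R integral {0..T} (\<lambda>s. weight (s / T) *\<^sub>R f s)) \<le> B"
    if f: "continuous_on UNIV f" "\<And>s. norm (f s) \<le> B" for f :: "real \<Rightarrow> complex" and B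
  proof -
    have wTB: "((\<lambda>s. weight (s / T) * B) has_integral T * B) {0..T}"
      by (rule has_integral_mult_left[OF wT])
    have "norm (integral {0..T} (\<lambda>s. weight (s / T) *\<^sub>R f s)) \<le> integral {0..T} (\<lambda>s. weight (s / T) * B)"
      by (rule integral_norm_bound_integral[OF int[OF f(1)]])
         (use wTB f(2) weight_nonneg in \<open>auto intro!: mult_left_mono\<close>)
    also have "\<dots> = T * B" using wTB by (rule integral_unique)
    finally show ?thesis using T by (simp add: pos_divide_le_eq mult.commute)
  qed
  have "((\<lambda>s. weight (s / T) *\<^sub>R (1 :: complex)) has_integral T *\<^sub>R 1) {0..T}"
    by (rule has_integral_scaleR_left[OF wT])
  then have one: "integral {0..T} (\<lambda>s. weight (s / T) *\<^sub>R (1 :: complex)) = of_real T"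
    by (simp add: integral_unique scaleR_conv_of_real)
  show ?thesis
    unfolding averaging_functional_def
  proof (intro conjI allI impI)
    show "(1 / T) *\<^sub>R integral {0..T} (\<lambda>s. weight (s / T) *\<^sub>R (1 :: complex)) = 1"
      using T by (simp only: one) (simp add: scaleR_conv_of_real)
  next
    fix f g :: "real \<Rightarrow> complex"
    assume "continuous_on UNIV f" "continuous_on UNIV g"
    from add[OF this] show "(1 / T) *\<^sub>R integral {0..T} (\<lambda>s. weight (s / T) *\<^sub>R (f s + g s)) =
        (1 / T) *\<^sub>R integral {0..T} (\<lambda>s. weight (s / T) *\<^sub>R f s) +
        (1 / T) *\<^sub>R integral {0..T} (\<lambda>s. weight (s / T) *\<^sub>R g s)"
      by (simp only: scaleR_right_distrib[symmetric])
  qed (simp_all only: mult mult_scaleR_right bound)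
qed

section \<open>Rates of convergence\<close>

lemma cont_diff_bounded_linear:
  assumes "bounded_linear h" "cont_diff n f"
  shows "cont_diff n (\<lambda>x. h (f x))"
  using assms(2)
proof (induction n arbitrary: f)
  case 0
  then show ?case by (simp add: bounded_linear.continuous_on[OF assms(1)])
next
  case (Suc n)
  have der: "((\<lambda>x. h (f x)) has_derivative (\<lambda>v. h (frechet_derivative f (at x) v))) (at x)" for x
    using Suc.prems
    by (intro bounded_linear.has_derivative[OF assms(1)])
       (simp add: differentiable_on_def frechet_derivative_works)
  have "frechet_derivative (\<lambda>x. h (f x)) (at x) = (\<lambda>v. h (frechet_derivative f (at x) v))" for x
    using frechet_derivative_at[OF der] by simp
  moreover have "(\<lambda>x. h (f x)) differentiable_on UNIV"
    using der unfolding differentiable_on_def by (auto intro: differentiableI)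
  ultimately show ?case using Suc by simp
qed

lemma prod_vec_nth: "(\<Prod>j\<in>A. v j) $ i = (\<Prod>j\<in>A. v j $ i)"
  for v :: "'j \<Rightarrow> real^'p"
  by (induction A rule: infinite_finite_induct) auto

lemma bounded_linear_complex_component: "bounded_linear (\<lambda>v. complex_of_real (v $ i))"
  by (intro bounded_linear_compose[OF bounded_linear_of_real] bounded_linear_vec_nth)

lemma infnorm_le_componentwise:
  fixes x :: "real^'n"
  assumes "\<And>i. \<bar>x $ i\<bar> \<le> B"
  shows "infnorm x \<le> B"
  unfolding infnorm_cart by (rule cSup_least) (use assms in auto)

text \<open>
  Transfer to vector-valued functions, component by component. The vector \<open>v\<close> stands for the weighted
  average, whose components are the values of the functional \<open>L\<close>.
\<close>
lemma averaging_functional_hadamard_product: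
  fixes F :: "'l::finite \<Rightarrow> real^'d \<Rightarrow> real^'p"
  assumes per: "\<And>j. torus_periodic (F j)" and cd: "\<And>j. cont_diff n (F j)"
    and s: "0 \<le> s" "real n > real CARD('d) + s"
  obtains C where "\<And>L \<epsilon> \<rho> \<theta> v. averaging_functional L \<Longrightarrow> 0 \<le> \<epsilon> \<Longrightarrow>
      damps_modes L \<rho> s \<epsilon> \<Longrightarrow>
      (\<forall>i. complex_of_real (v $ i) = L (\<lambda>t. \<Prod>j\<in>UNIV. complex_of_real (F j (\<theta> + t *\<^sub>R \<rho> $ j) $ i))) \<Longrightarrow>
      infnorm (v - spatial_average F) \<le> \<epsilon> * C"
proof -
  define f where "f i j x = complex_of_real (F j x $ i)" for i j x
  have cdf: "cont_diff n (f i j)" for i j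
    unfolding f_def by (rule cont_diff_bounded_linear[OF bounded_linear_complex_component cd])
  have perf: "torus_periodic (f i j)" for i j
    using per[of j] by (simp add: torus_periodic_def f_def)
  define rate where "rate i C \<longleftrightarrow> C \<ge> 0 \<and> (\<forall>L \<epsilon> \<rho> \<theta>. averaging_functional L \<longrightarrow> 0 \<le> \<epsilon> \<longrightarrow>
      damps_modes L \<rho> s \<epsilon> \<longrightarrow>
      norm (L (\<lambda>t. \<Prod>j\<in>UNIV. f i j (\<theta> + t *\<^sub>R \<rho> $ j)) - (\<Prod>j\<in>UNIV. integral torus (f i j))) \<le> \<epsilon> * C)"
    for i C
  have "\<exists>C. rate i C" for i
    by (rule averaging_functional_torus_product[of "f i", OF perf cdf s]) (auto simp: rate_def)
  then obtain C where C: "\<And>i. rate i (C i)" by metis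
  have average: "complex_of_real (spatial_average F $ i) = (\<Prod>j\<in>UNIV. integral torus (f i j))" for i
  proof -
    have "integral torus (f i j) = complex_of_real (integral torus (F j) $ i)" for j
      using integral_linear[OF integrable_on_torus[OF cont_diff_continuous[OF cd[of j]]]
          bounded_linear_complex_component[of i]]
      by (simp add: o_def f_def[abs_def])
    then show ?thesis by (simp add: spatial_average_def prod_vec_nth)
  qed
  show thesis
  proof (rule that)
    fix L \<epsilon> and \<rho> :: "real^'d^'l" and \<theta> and v :: "real^'p"
    assume L: "averaging_functional L" and \<epsilon>: "0 \<le> \<epsilon>"
      and small: "damps_modes L \<rho> s \<epsilon>"
      and v: "\<forall>i. complex_of_real (v $ i) = L (\<lambda>t. \<Prod>j\<in>UNIV. complex_of_real (F j (\<theta> + t *\<^sub>R \<rho> $ j) $ i))"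
    show "infnorm (v - spatial_average F) \<le> \<epsilon> * (\<Sum>i\<in>UNIV. C i)"
    proof (rule infnorm_le_componentwise)
      fix i
      have "\<bar>(v - spatial_average F) $ i\<bar> = norm (complex_of_real (v $ i) - complex_of_real (spatial_average F $ i))"
        by (simp flip: of_real_diff)
      also have "\<dots> \<le> \<epsilon> * C i"
        using C[of i] L \<epsilon> small unfolding average f_def v[rule_format] rate_def by blast
      also have "\<dots> \<le> \<epsilon> * (\<Sum>i\<in>UNIV. C i)"
        using C by (intro mult_left_mono \<epsilon> member_le_sum) (auto simp: rate_def)
      finally show "\<bar>(v - spatial_average F) $ i\<bar> \<le> \<epsilon> * (\<Sum>i\<in>UNIV. C i)" .
    qed
  qed
qed

lemma DMW_component:
  assumes "\<And>j. torus_periodic (F j)"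
  shows "complex_of_real (DMW F \<rho> N \<theta> $ i) = (1 / weight_sum N) *\<^sub>R (\<Sum>n<N. weight (real n / real N) *\<^sub>R
      (\<Prod>j\<in>UNIV. complex_of_real (F j (\<theta> + real n *\<^sub>R \<rho> $ j) $ i)))"
  by (simp add: DMW_def prod_vec_nth torus_periodic_rotation[OF assms]
      scaleR_conv_of_real[where 'a = complex])

lemma CMW_component:
  assumes per: "\<And>j. torus_periodic (F j)" and cont: "\<And>j. continuous_on UNIV (F j)" and T: "0 < T"
  shows "complex_of_real (CMW F \<rho> T \<theta> $ i) = (1 / T) *\<^sub>R integral {0..T} (\<lambda>s. weight (s / T) *\<^sub>R
      (\<Prod>j\<in>UNIV. complex_of_real (F j (\<theta> + s *\<^sub>R \<rho> $ j) $ i)))"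
proof -
  define g where "g s = weight (s / T) *\<^sub>R (\<Prod>j\<in>UNIV. F j (\<theta> + s *\<^sub>R \<rho> $ j))" for s
  have "continuous_on {0..T} (\<lambda>s. F j (\<theta> + s *\<^sub>R \<rho> $ j))" for j
    by (rule continuous_on_compose2[OF cont]) (auto intro!: continuous_intros)
  moreover have "g = (\<lambda>s. \<chi> i. weight (s / T) * (\<Prod>j\<in>UNIV. F j (\<theta> + s *\<^sub>R \<rho> $ j) $ i))"
    by (simp add: g_def vec_eq_iff prod_vec_nth fun_eq_iff)
  ultimately have "continuous_on {0..T} g"
    using T by (simp only:) (intro continuous_intros, auto)
  then have "g integrable_on {0..T}" by (rule integrable_continuous_interval)
  from integral_linear[OF this bounded_linear_complex_component[of i]]
  have "complex_of_real (integral {0..T} g $ i) = integral {0..T} (\<lambda>s. complex_of_real (g s $ i))"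
    by (simp add: o_def)
  moreover have "CMW F \<rho> T \<theta> = (1 / T) *\<^sub>R integral {0..T} g"
    by (simp add: CMW_def g_def[abs_def] torus_periodic_rotation[OF per])
  ultimately show ?thesis
    by (simp add: g_def prod_vec_nth scaleR_conv_of_real[where 'a = complex])
qed

text \<open>
  A small divisor \<open>\<alpha> / x powr \<tau>\<close>, taken to the power \<open>m\<close>, becomes the growth \<open>x powr (m * \<tau>)\<close>
  that \<open>damps_modes\<close> allows.
\<close>
lemma diophantine_small_divisor:
  assumes "0 < \<alpha>" "0 < x"
  shows "C / y / (\<alpha> / x powr \<tau>) ^ m = C / \<alpha> ^ m / y * x powr (real m * \<tau>)"
proof -
  have "(x powr \<tau>) ^ m = x powr (real m * \<tau>)"
    using assms(2) by (simp add: powr_realpow[symmetric] powr_powr mult.commute)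
  then show ?thesis by (simp add: power_divide)
qed

lemma int_norm1_pos:
  assumes "k \<noteq> 0"
  shows "int_norm1 k > 0"
proof -
  obtain j i where "k $ j $ i \<noteq> 0" using assms by (auto simp: vec_eq_iff)
  then have "0 < \<bar>real_of_int (k $ j $ i)\<bar>" by simp
  also have "\<dots> \<le> (\<Sum>i\<in>UNIV. \<bar>real_of_int (k $ j $ i)\<bar>)" by (rule member_le_sum) auto
  also have "\<dots> \<le> int_norm1 k"
    unfolding int_norm1_def
    by (rule member_le_sum[of j UNIV "\<lambda>j. \<Sum>i\<in>UNIV. \<bar>real_of_int (k $ j $ i)\<bar>"])
       (auto intro: sum_nonneg)
  finally show ?thesis .
qed

lemma joint_diophantine_exponent_pos:
  fixes \<rho> :: "real^'d^'l"
  assumes "joint_diophantine_discrete \<tau> \<rho> \<or> joint_diophantine_continuous \<tau> \<rho>"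
  shows "0 < \<tau>"
proof -
  have "1 \<le> CARD('d) * CARD('l)" by (simp add: Suc_le_eq)
  then have "1 \<le> real (CARD('d) * CARD('l))" by linarith
  then show ?thesis
    using assms unfolding joint_diophantine_discrete_def joint_diophantine_continuous_def by linarith
qed

lemma DMW_convergence_rate:
  fixes F :: "'l::finite \<Rightarrow> real^'d \<Rightarrow> real^'p" and \<rho> :: "real^'d^'l"
  assumes per: "\<And>j. torus_periodic (F j)" and cd: "\<And>j. cont_diff n (F j)"
    and n: "real n > real CARD('d) + real m * \<tau>"
    and dioph: "joint_diophantine_discrete \<tau> \<rho>"
  shows "\<exists>C. \<forall>N\<ge>4. \<forall>\<theta>. infnorm (DMW F \<rho> N \<theta> - spatial_average F) \<le> C * real N powi (- int m)"
proof -
  obtain \<alpha> where \<alpha>: "\<alpha> > 0"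
    "\<And>k n. k \<noteq> 0 \<Longrightarrow> \<alpha> / int_norm1 k powr \<tau> \<le> \<bar>int_dot k \<rho> - real_of_int n\<bar>"
    using dioph unfolding joint_diophantine_discrete_def by blast
  have \<tau>: "0 \<le> real m * \<tau>"
    using joint_diophantine_exponent_pos[of \<tau> \<rho>] dioph by simp
  obtain C where C: "\<And>L \<epsilon> (\<rho> :: real^'d^'l) \<theta> v. averaging_functional L \<Longrightarrow> 0 \<le> \<epsilon> \<Longrightarrow>
    damps_modes L \<rho> (real m * \<tau>) \<epsilon> \<Longrightarrow>
    (\<forall>i. complex_of_real (v $ i) = L (\<lambda>t. \<Prod>j\<in>UNIV. complex_of_real (F j (\<theta> + t *\<^sub>R \<rho> $ j) $ i))) \<Longrightarrow>
    infnorm (v - spatial_average F) \<le> \<epsilon> * C"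
    by (rule averaging_functional_hadamard_product[where F = F, OF per cd \<tau> n]) (blast intro: that)
  obtain C0 where C0: "C0 \<ge> 0" "\<And>N \<beta> \<delta>. 4 \<le> N \<Longrightarrow> 0 < \<delta> \<Longrightarrow> (\<And>n::int. \<delta> \<le> \<bar>\<beta> - of_int n\<bar>) \<Longrightarrow>
    norm ((1 / weight_sum N) *\<^sub>R
      (\<Sum>n<N. weight (real n / real N) *\<^sub>R cis (2 * pi * (\<beta> * real n))))
    \<le> C0 / real N ^ m / \<delta> ^ m"
    by (rule weighted_exponential_sum_bound[of m]) (blast intro: that)
  have "infnorm (DMW F \<rho> N \<theta> - spatial_average F) \<le> (C0 / \<alpha> ^ m * C) * real N powi (- int m)"
    if N: "4 \<le> N" for N \<theta>
  proof -
    have "infnorm (DMW F \<rho> N \<theta> - spatial_average F) \<le> C0 / \<alpha> ^ m / real N ^ m * C"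
    proof (rule C[OF averaging_functional_discrete[OF N]])
      show "damps_modes
          (\<lambda>f. (1 / weight_sum N) *\<^sub>R (\<Sum>n<N. weight (real n / real N) *\<^sub>R f (real n)))
          \<rho> (real m * \<tau>) (C0 / \<alpha> ^ m / real N ^ m)"
        unfolding damps_modes_def
      proof (intro allI impI)
        fix k :: "int^'d^'l" assume k: "k \<noteq> 0"
        note pos = int_norm1_pos[OF k]
        have "norm ((1 / weight_sum N) *\<^sub>R
            (\<Sum>n<N. weight (real n / real N) *\<^sub>R cis (2 * pi * (int_dot k \<rho> * real n))))
          \<le> C0 / real N ^ m / (\<alpha> / int_norm1 k powr \<tau>) ^ m"
          using \<alpha>(1) pos by (intro C0(2) N \<alpha>(2) k) auto
        then show "norm ((1 / weight_sum N) *\<^sub>R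
            (\<Sum>n<N. weight (real n / real N) *\<^sub>R cis (2 * pi * (int_dot k \<rho> * real n))))
          \<le> C0 / \<alpha> ^ m / real N ^ m * int_norm1 k powr (real m * \<tau>)"
          by (simp only: diophantine_small_divisor[OF \<alpha>(1) pos])
      qed
    qed (use C0(1) \<alpha>(1) DMW_component[where F = F, OF per] in auto)
    then show ?thesis by (simp add: power_int_minus divide_inverse mult_ac)
  qed
  then show ?thesis by blast
qed

lemma CMW_convergence_rate:
  fixes F :: "'l::finite \<Rightarrow> real^'d \<Rightarrow> real^'p" and \<rho> :: "real^'d^'l"
  assumes per: "\<And>j. torus_periodic (F j)" and cd: "\<And>j. cont_diff n (F j)"
    and n: "real n > real CARD('d) + real m * \<tau>"
    and dioph: "joint_diophantine_continuous \<tau> \<rho>"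
  shows "\<exists>C. \<forall>T>0. \<forall>\<theta>. infnorm (CMW F \<rho> T \<theta> - spatial_average F) \<le> C * T powi (- int m)"
proof -
  obtain \<alpha> where \<alpha>: "\<alpha> > 0"
    "\<And>k. k \<noteq> 0 \<Longrightarrow> \<alpha> / int_norm1 k powr \<tau> \<le> \<bar>int_dot k \<rho>\<bar>"
    using dioph unfolding joint_diophantine_continuous_def by blast
  have \<tau>: "0 \<le> real m * \<tau>"
    using joint_diophantine_exponent_pos[of \<tau> \<rho>] dioph by simp
  have cont: "continuous_on UNIV (F j)" for j by (rule cont_diff_continuous[OF cd])
  obtain C where C: "\<And>L \<epsilon> (\<rho> :: real^'d^'l) \<theta> v. averaging_functional L \<Longrightarrow> 0 \<le> \<epsilon> \<Longrightarrow>
    damps_modes L \<rho> (real m * \<tau>) \<epsilon> \<Longrightarrow>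
    (\<forall>i. complex_of_real (v $ i) = L (\<lambda>t. \<Prod>j\<in>UNIV. complex_of_real (F j (\<theta> + t *\<^sub>R \<rho> $ j) $ i))) \<Longrightarrow>
    infnorm (v - spatial_average F) \<le> \<epsilon> * C"
    by (rule averaging_functional_hadamard_product[where F = F, OF per cd \<tau> n]) (blast intro: that)
  obtain C0 where C0: "C0 \<ge> 0" "\<And>T \<beta> \<delta>. 0 < T \<Longrightarrow> 0 < \<delta> \<Longrightarrow> \<delta> \<le> \<bar>\<beta>\<bar> \<Longrightarrow>
    norm ((1 / T) *\<^sub>R integral {0..T} (\<lambda>s. weight (s / T) *\<^sub>R cis (2 * pi * (\<beta> * s))))
    \<le> C0 / T ^ m / \<delta> ^ m"
    by (rule weighted_exponential_integral_bound[of m]) (blast intro: that)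
  have "infnorm (CMW F \<rho> T \<theta> - spatial_average F) \<le> (C0 / \<alpha> ^ m * C) * T powi (- int m)"
    if T: "0 < T" for T \<theta>
  proof -
    have "infnorm (CMW F \<rho> T \<theta> - spatial_average F) \<le> C0 / \<alpha> ^ m / T ^ m * C"
    proof (rule C[OF averaging_functional_continuous[OF T]])
      show "damps_modes
          (\<lambda>f. (1 / T) *\<^sub>R integral {0..T} (\<lambda>s. weight (s / T) *\<^sub>R f s))
          \<rho> (real m * \<tau>) (C0 / \<alpha> ^ m / T ^ m)"
        unfolding damps_modes_def
      proof (intro allI impI)
        fix k :: "int^'d^'l" assume k: "k \<noteq> 0"
        note pos = int_norm1_pos[OF k]
        have "norm ((1 / T) *\<^sub>R integral {0..T} (\<lambda>s. weight (s / T) *\<^sub>R cis (2 * pi * (int_dot k \<rho> * s))))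
          \<le> C0 / T ^ m / (\<alpha> / int_norm1 k powr \<tau>) ^ m"
          using \<alpha>(1) pos by (intro C0(2) T \<alpha>(2) k) auto
        then show "norm ((1 / T) *\<^sub>R integral {0..T} (\<lambda>s. weight (s / T) *\<^sub>R cis (2 * pi * (int_dot k \<rho> * s))))
          \<le> C0 / \<alpha> ^ m / T ^ m * int_norm1 k powr (real m * \<tau>)"
          by (simp only: diophantine_small_divisor[OF \<alpha>(1) pos])
      qed
    qed (use C0(1) \<alpha>(1) T CMW_component[where F = F, OF per cont T] in auto)
    then show ?thesis by (simp add: power_int_minus divide_inverse mult_ac)
  qed
  then show ?thesis by blast
qed

theorem theorem4p1:
  fixes F :: "'l::finite \<Rightarrow> real^'d::finite \<Rightarrow> real^'p::finite"
    and \<rho> :: "real^'d^'l"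
    and M :: "'l \<Rightarrow> enat"
    and m :: nat
    and \<tau> :: real
  assumes "\<And>j. 2 \<le> M j"
    and "\<And>j. smooth_on_torus (M j) (F j)"
    and "\<And>j. \<rho> $ j \<in> torus"
    and "2 \<le> m"
    and "ereal_of_enat (Min (range M)) > ereal (real CARD('d) + real m * \<tau>)"
  shows "(joint_diophantine_discrete \<tau> \<rho> \<longrightarrow>
           (\<exists>C. \<forall>\<^sub>F N in sequentially. \<forall>\<theta>\<in>torus.
              infnorm (DMW F \<rho> N \<theta> - spatial_average F) \<le> C * real N powi (- int m))) \<and>
         (joint_diophantine_continuous \<tau> \<rho> \<longrightarrow>
           (\<exists>C. \<forall>\<^sub>F T in at_top. \<forall>\<theta>\<in>torus.
              infnorm (CMW F \<rho> T \<theta> - spatial_average F) \<le> C * T powi (- int m)))"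
proof -
  \<comment> \<open>If the common smoothness is infinite, any sufficiently large finite order will do.\<close>
  obtain n where n: "enat n \<le> Min (range M)" "real n > real CARD('d) + real m * \<tau>"
  proof (cases "Min (range M)")
    case (enat K)
    then show thesis using that[of K] assms(5) by simp
  next
    case infinity
    obtain K :: nat where "real K > real CARD('d) + real m * \<tau>" using reals_Archimedean2 by blast
    then show thesis using that[of K] infinity by simp
  qed
  have "enat n \<le> M j" for j using n(1) by (simp add: order_trans)
  then have per: "torus_periodic (F j)" and cd: "cont_diff n (F j)" for j
    using assms(2)[of j] by (auto simp: smooth_on_torus_def)
  show ?thesis
  proof (intro conjI impI)
    assume "joint_diophantine_discrete \<tau> \<rho>"
    from DMW_convergence_rate[where F = F, OF per cd n(2) this] obtain C where
      "\<And>N \<theta>. 4 \<le> N \<Longrightarrow> infnorm (DMW F \<rho> N \<theta> - spatial_average F) \<le> C * real N powi (- int m)"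
      by blast
    then have "\<forall>\<^sub>F N in sequentially. \<forall>\<theta>\<in>torus.
        infnorm (DMW F \<rho> N \<theta> - spatial_average F) \<le> C * real N powi (- int m)"
      by (intro eventually_sequentiallyI[of 4]) blast
    then show "\<exists>C. \<forall>\<^sub>F N in sequentially. \<forall>\<theta>\<in>torus.
        infnorm (DMW F \<rho> N \<theta> - spatial_average F) \<le> C * real N powi (- int m)" ..
  next
    assume "joint_diophantine_continuous \<tau> \<rho>"
    from CMW_convergence_rate[where F = F, OF per cd n(2) this] obtain C where
      "\<And>T \<theta>. 0 < T \<Longrightarrow> infnorm (CMW F \<rho> T \<theta> - spatial_average F) \<le> C * T powi (- int m)"
      by blast
    then have "\<forall>\<^sub>F T in at_top. \<forall>\<theta>\<in>torus.
        infnorm (CMW F \<rho> T \<theta> - spatial_average F) \<le> C * T powi (- int m)"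
      by (intro eventually_mono[OF eventually_gt_at_top[of "0::real"]]) blast
    then show "\<exists>C. \<forall>\<^sub>F T in at_top. \<forall>\<theta>\<in>torus.
        infnorm (CMW F \<rho> T \<theta> - spatial_average F) \<le> C * T powi (- int m)" ..
  qed
qed

end
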